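(* Consider the two-player multi-stage Bayesian game with stages $k=0,1,\dots,K$ and double-sided incomplete information described in the context, with a given sequence of beliefs $b_i^k$ for each player $i\in\{1,2\}$ and each stage $k$, and with expected cumulative utilities $U_i^{k_0:K}$. Let $(\sigma_1^{*,K},\sigma_2^{*,K})$ be final-stage strategies forming a Static Bayesian Nash Equilibrium at every state $x^K\in X^K$ under $(b_1^K,b_2^K)$. Let $\alpha_1(\theta_1)$, $\theta_1\in\Theta_1$, and $\alpha_2(\theta_2)$, $\theta_2\in\Theta_2$, be any strictly positive finite numbers. For a sequence of strategy pairs $(\sigma_1^{*,0:K-1},\sigma_2^{*,0:K-1})$, completed by $(\sigma_1^{*,K},\sigma_2^{*,K})$, write $V_i^{k}(x^{k},\theta_i):=U_i^{k:K}(\sigma_i^{*,k:K},\sigma_j^{*,k:K},x^{k},\theta_i)$ for $k\in\{0,\dots,K\}$. For $k\in\{0,\dots,K-1\}$ and $x^k\in X^k$, let $C^k$ be the optimization problem, in the variables $\sigma_i^k(\cdot\mid x^k,\theta_i)\in\Delta(A_i^k)$ and $s_i^k(x^k,\theta_i)\in\mathbb{R}$ ($\theta_i\in\Theta_i$, $i\in\{1,2\}$), $$\begin{aligned} \max_{\sigma_1^k,\sigma_2^k,s_1^k,s_2^k}\ \sum_{i=1}^2\sum_{\theta_i\in\Theta_i}\alpha_i(\theta_i)\Big\{& s_i^k(x^k,\theta_i)+\sum_{\theta_j\in\Theta_j}b_i^k(\theta_j\mid x^k,\theta_i)\sum_{a_1^k\in A_1^k}\sigma_1^k(a_1^k\mid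 x^k,\theta_1)\sum_{a_2^k\in A_2^k}\sigma_2^k(a_2^k\mid x^k,\theta_2)\\ &\cdot\big[J_i^k(x^k,a_1^k,a_2^k,\theta_1,\theta_2)+V_i^{k+1}(f^k(x^k,a_1^k,a_2^k),\theta_i)\big]\Big\} \end{aligned}$$ (where $j\ne i$) subject to (a) for all $\theta_2\in\Theta_2$ and $a_2^k\in A_2^k$, $$\sum_{\theta_1\in\Theta_1}b_2^k(\theta_1\mid x^k,\theta_2)\sum_{a_1^k\in A_1^k}\sigma_1^k(a_1^k\mid x^k,\theta_1)\big[J_2^k(x^k,a_1^k,a_2^k,\theta_1,\theta_2)+V_2^{k+1}(f^k(x^k,a_1^k,a_2^k),\theta_2)\big]\le -s_2^k(x^k,\theta_2);$$ (b) for all $\theta_1\in\Theta_1$ and $a_1^k\in A_1^k$, $$\sum_{\theta_2\in\Theta_2}b_1^k(\theta_2\mid x^k,\theta_1)\sum_{a_2^k\in A_2^k}\sigma_2^k(a_2^k\mid x^k,\theta_2)\big[J_1^k(x^k,a_1^k,a_2^k,\theta_1,\theta_2)+V_1^{k+1}(f^k(x^k,a_1^k,a_2^k),\theta_1)\big]\le -s_1^k(x^k,\theta_1).$$ Then $(\sigma_1^{*,0:K-1},\sigma_2^{*,0:K-1})$ (together with the final-stage pair $(\sigma_1^{*,K},\sigma_2^{*,K})$) constitutes a Dynamic Bayesian Nash Equilibrium (DBNE) if and only if for each $k\in\{0,1,\dots,K-1\}$ and each $x^k\in X^k$ there are numbers $s_1^{*,k}(x^k,\theta_1)$, $s_2^{*,k}(x^k,\theta_2)$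 such that $\sigma_1^{*,k},\sigma_2^{*,k},s_1^{*,k},s_2^{*,k}$ is an optimal solution of $C^k$ at $x^k$. Moreover, the optimum of each $C^k$ exists and is attained with constraints (a), (b) tight in the sense that $s_i^{*,k}(x^k,\theta_i)=-V_i^k(x^k,\theta_i)$ for all $\theta_i\in\Theta_i$ and $i\in\{1,2\}$.
   Context: Setting. There are two players $i\in\{1,2\}$; $j$ denotes the player other than $i$. Player $i$ has a private type $\theta_i$ in a finite nonempty set $\Theta_i$. At each stage $k\in\{0,\dots,K\}$ there is a set of states $X^k$, and player $i$ has a finite nonempty action set $A_i^k$. The state evolves by known transition functions $x^{k+1}=f^k(x^k,a_1^k,a_2^k)\in X^{k+1}$, $k\in\{0,\dots,K-1\}$. The expected stage utility of player $i$ at stage $k$ is a real-valued function $J_i^k(x^k,a_1^k,a_2^k,\theta_1,\theta_2)$. $\Delta(A)$ denotes the set of probability distributions on a finite set $A$. Strategies. A behavioral strategy of player $i$ at stage $k$ is a map $\sigma_i^k: X^k\times\Theta_i\to\Delta(A_i^k)$, with $\sigma_i^k(a_i^k\mid x^k,\theta_i)$ the probability of action $a_i^k$; $\Sigma_i^k$ is the set of all such maps. $\sigma_i^{k_0:k_1}=(\sigma_i^{k})_{k=k_0,\dots,k_1}$. Beliefs. For each $k$, $x^k\in X^k$ and $\theta_i\in\Theta_i$, $b_i^k(\cdot\mid x^k,\theta_i)$ is a given probability distribution on $\Theta_j$. The belief sequences are arbitrary and given; no consistency with the strategies is required. Expected cumulative utility. For initial stage $k_0$, state $x^{k_0}$ and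 own type $\theta_i$, $$U_i^{k_0:K}(\sigma_i^{k_0:K},\sigma_j^{k_0:K},x^{k_0},\theta_i):=\sum_{k=k_0}^K\mathbb{E}_{\theta_j\sim b_i^k,\,a_i^k\sim\sigma_i^k,\,a_j^k\sim\sigma_j^k}\big[J_i^k(x^k,a_1^k,a_2^k,\theta_1,\theta_2)\big],$$ where at each stage $k$, given $x^k$, the opponent's type $\theta_j$ is distributed according to $b_i^k(\cdot\mid x^k,\theta_i)$, the actions are drawn (conditionally independently) from $\sigma_i^k(\cdot\mid x^k,\theta_i)$ and $\sigma_j^k(\cdot\mid x^k,\theta_j)$, and $x^{k+1}=f^k(x^k,a_1^k,a_2^k)$. Equivalently, with the convention $U_i^{K+1:K}\equiv 0$ (so that for $k=K$ only the $J_i^K$ term remains), $$U_i^{k:K}(\sigma_i^{k:K},\sigma_j^{k:K},x^k,\theta_i)=\sum_{\theta_j}b_i^k(\theta_j\mid x^k,\theta_i)\sum_{a_1^k,a_2^k}\sigma_1^k(a_1^k\mid x^k,\theta_1)\sigma_2^k(a_2^k\mid x^k,\theta_2)\big[J_i^k(x^k,a_1^k,a_2^k,\theta_1,\theta_2)+U_i^{k+1:K}(\sigma_i^{k+1:K},\sigma_j^{k+1:K},f^k(x^k,a_1^k,a_2^k),\theta_i)\big].$$ DBNE. Under the given beliefs, strategies $(\sigma_1^{*,0:K},\sigma_2^{*,0:K})$ constitute a Dynamic Bayesian Nash Equilibrium if for every $k_0\in\{0,\dots,K\}$, every $x^{k_0}\in X^{k_0}$, each $i\in\{1,2\}$ and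 $j\neq i$, and every $\theta_i\in\Theta_i$, $$U_i^{k_0:K}(\sigma_i^{*,k_0:K},\sigma_j^{*,k_0:K},x^{k_0},\theta_i)\ \ge\ U_i^{k_0:K}(\sigma_i^{k_0:K},\sigma_j^{*,k_0:K},x^{k_0},\theta_i)\qquad\forall\,\sigma_i^{k_0:K}\in\prod_{k=k_0}^K\Sigma_i^k.$$ SBNE at the final stage. $(\sigma_1^{*,K},\sigma_2^{*,K})$ is a Static Bayesian Nash Equilibrium at $x^K$ under $(b_1^K,b_2^K)$ if for each $i$, $j\ne i$ and every $\theta_i\in\Theta_i$, $U_i^{K:K}(\sigma_i^{*,K},\sigma_j^{*,K},x^K,\theta_i)\ge U_i^{K:K}(\sigma_i^{K},\sigma_j^{*,K},x^K,\theta_i)$ for all $\sigma_i^K\in\Sigma_i^K$. *)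

theory Defs
  imports "HOL-Probability.Probability"
begin

datatype player = P1 | P2

fun opp :: "player \<Rightarrow> player" where
  "opp P1 = P2"
| "opp P2 = P1"

text \<open>
  Both players draw their types from a common HOL type \<open>'t\<close> and their actions from a common HOL
  type \<open>'a\<close>; the actual type and action sets are the carriers \<open>types G i\<close> and \<open>actions G i k\<close>,
  which may be unrelated for the two players and, for actions, change with the stage.
  The arguments of \<open>transition\<close> and \<open>payoff\<close> are in the order \<open>x a1 a2\<close> and \<open>x a1 a2 \<theta>1 \<theta>2\<close>
  whichever player is considered.  \<open>belief G i k x \<theta>\<close> is player \<open>i\<close>'s belief about the opponent's
  type.
\<close>

record ('x, 't, 'a) bayes_game =
  horizon :: nat
  types :: "player \<Rightarrow> 't set"
  states :: "nat \<Rightarrow> 'x set"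
  actions :: "player \<Rightarrow> nat \<Rightarrow> 'a set"
  transition :: "nat \<Rightarrow> 'x \<Rightarrow> 'a \<Rightarrow> 'a \<Rightarrow> 'x"
  payoff :: "player \<Rightarrow> nat \<Rightarrow> 'x \<Rightarrow> 'a \<Rightarrow> 'a \<Rightarrow> 't \<Rightarrow> 't \<Rightarrow> real"
  belief :: "player \<Rightarrow> nat \<Rightarrow> 'x \<Rightarrow> 't \<Rightarrow> 't pmf"

definition bayes_game :: "('x, 't, 'a) bayes_game \<Rightarrow> bool" where
  "bayes_game G \<longleftrightarrow>
     (\<forall>i. finite (types G i) \<and> types G i \<noteq> {}) \<and>
     (\<forall>i. \<forall>k\<le>horizon G. finite (actions G i k) \<and> actions G i k \<noteq> {}) \<and>
     (\<forall>k<horizon G. \<forall>x\<in>states G k. \<forall>a1\<in>actions G P1 k. \<forall>a2\<in>actions G P2 k.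
        transition G k x a1 a2 \<in> states G (Suc k)) \<and>
     (\<forall>i. \<forall>k\<le>horizon G. \<forall>x\<in>states G k. \<forall>\<theta>\<in>types G i.
        set_pmf (belief G i k x \<theta>) \<subseteq> types G (opp i))"

type_synonym ('x, 't, 'a) strategy = "nat \<Rightarrow> 'x \<Rightarrow> 't \<Rightarrow> 'a pmf"

definition stage_strategies ::
    "('x, 't, 'a) bayes_game \<Rightarrow> player \<Rightarrow> nat \<Rightarrow> ('x \<Rightarrow> 't \<Rightarrow> 'a pmf) set" where
  "stage_strategies G i k =
     {s. \<forall>x\<in>states G k. \<forall>\<theta>\<in>types G i. set_pmf (s x \<theta>) \<subseteq> actions G i k}"

text \<open>
  Strategies on the stages from \<open>k\<close> to the horizon; values at other stages are irrelevant and
  left unconstrained.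
\<close>

definition strategies ::
    "('x, 't, 'a) bayes_game \<Rightarrow> player \<Rightarrow> nat \<Rightarrow> ('x, 't, 'a) strategy set" where
  "strategies G i k = Pi {k..horizon G} (stage_strategies G i)"

text \<open>
  \<open>pairing i u v\<close> is the profile that assigns \<open>u\<close> to player \<open>i\<close> and \<open>v\<close> to the opponent of \<open>i\<close>.
\<close>

definition pairing :: "player \<Rightarrow> 'b \<Rightarrow> 'b \<Rightarrow> player \<Rightarrow> 'b" where
  "pairing i u v p = (if p = i then u else v)"

text \<open>
  Joint law, from the point of view of player \<open>i\<close> of type \<open>\<theta>\<close> in state \<open>x\<close> at stage \<open>k\<close>, of the
  opponent's type and the two actions.
\<close>

definition stage_draw ::
    "('x, 't, 'a) bayes_game \<Rightarrow> (player \<Rightarrow> ('x, 't, 'a) strategy) \<Rightarrow> player \<Rightarrow> nat \<Rightarrow> 'x \<Rightarrow> 't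
      \<Rightarrow> ('t \<times> 'a \<times> 'a) pmf" where
  "stage_draw G \<sigma> i k x \<theta> =
     bind_pmf (belief G i k x \<theta>) (\<lambda>\<theta>'.
     bind_pmf (\<sigma> P1 k x (pairing i \<theta> \<theta>' P1)) (\<lambda>a1.
     bind_pmf (\<sigma> P2 k x (pairing i \<theta> \<theta>' P2)) (\<lambda>a2.
     return_pmf (\<theta>', a1, a2))))"

definition stage_utility ::
    "('x, 't, 'a) bayes_game \<Rightarrow> (player \<Rightarrow> ('x, 't, 'a) strategy) \<Rightarrow> player \<Rightarrow> nat \<Rightarrow> 'x \<Rightarrow> 't
      \<Rightarrow> real" where
  "stage_utility G \<sigma> i k x \<theta> =
     measure_pmf.expectation (stage_draw G \<sigma> i k x \<theta>)
       (\<lambda>(\<theta>', a1, a2). payoff G i k x a1 a2 (pairing i \<theta> \<theta>' P1) (pairing i \<theta> \<theta>' P2))"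

definition next_state ::
    "('x, 't, 'a) bayes_game \<Rightarrow> (player \<Rightarrow> ('x, 't, 'a) strategy) \<Rightarrow> player \<Rightarrow> nat \<Rightarrow> 'x \<Rightarrow> 't
      \<Rightarrow> 'x pmf" where
  "next_state G \<sigma> i k x \<theta> =
     map_pmf (\<lambda>(\<theta>', a1, a2). transition G k x a1 a2) (stage_draw G \<sigma> i k x \<theta>)"

text \<open>
  \<open>state_law G \<sigma> i k x \<theta> d\<close> is the law of the state at stage \<open>k + d\<close> when play starts in state
  \<open>x\<close> at stage \<open>k\<close>.  The opponent's type is drawn anew at each stage from the belief at that
  stage.
\<close>

primrec state_law ::
    "('x, 't, 'a) bayes_game \<Rightarrow> (player \<Rightarrow> ('x, 't, 'a) strategy) \<Rightarrow> player \<Rightarrow> nat \<Rightarrow> 'x \<Rightarrow> 't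
      \<Rightarrow> nat \<Rightarrow> 'x pmf" where
  "state_law G \<sigma> i k x \<theta> 0 = return_pmf x"
| "state_law G \<sigma> i k x \<theta> (Suc d) =
     bind_pmf (state_law G \<sigma> i k x \<theta> d) (\<lambda>y. next_state G \<sigma> i (k + d) y \<theta>)"

text \<open>
  Expected utility of player \<open>i\<close> cumulated over the stages from \<open>k\<close> to the horizon; it vanishes
  for \<open>k = Suc (horizon G)\<close>.
\<close>

definition utility ::
    "('x, 't, 'a) bayes_game \<Rightarrow> (player \<Rightarrow> ('x, 't, 'a) strategy) \<Rightarrow> player \<Rightarrow> nat \<Rightarrow> 'x \<Rightarrow> 't
      \<Rightarrow> real" where
  "utility G \<sigma> i k x \<theta> =
     (\<Sum>l = k..horizon G.
        measure_pmf.expectation (state_law G \<sigma> i k x \<theta> (l - k)) (\<lambda>y. stage_utility G \<sigma> i l y \<theta>))"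

lemma finite_types: "bayes_game G \<Longrightarrow> finite (types G i)"
  by (simp add: bayes_game_def)

lemma finite_actions: "bayes_game G \<Longrightarrow> k \<le> horizon G \<Longrightarrow> finite (actions G i k)"
  by (simp add: bayes_game_def)

lemma trans_in_states:
  assumes "bayes_game G" "k < horizon G" "x \<in> states G k"
    "a1 \<in> actions G P1 k" "a2 \<in> actions G P2 k"
  shows "transition G k x a1 a2 \<in> states G (Suc k)"
  using assms by (simp add: bayes_game_def)

lemma belief_support:
  assumes "bayes_game G" "k \<le> horizon G" "x \<in> states G k" "\<theta> \<in> types G i"
  shows "set_pmf (belief G i k x \<theta>) \<subseteq> types G (opp i)"
  using assms by (simp add: bayes_game_def)

lemma pairing_in_types:
  assumes "\<theta> \<in> types G i" "\<theta>' \<in> types G (opp i)"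
  shows "pairing i \<theta> \<theta>' p \<in> types G p"
  using assms by (cases i; cases p) (auto simp: pairing_def)

lemma strategies_support:
  assumes "\<And>i. \<sigma> i \<in> strategies G i k" "k \<le> l" "l \<le> horizon G"
    "x \<in> states G l" "\<theta> \<in> types G p"
  shows "set_pmf (\<sigma> p l x \<theta>) \<subseteq> actions G p l"
proof -
  have "\<sigma> p l \<in> stage_strategies G p l"
    using assms(1)[of p] assms(2,3) unfolding strategies_def by (simp add: Pi_def)
  thus ?thesis
    using assms(4,5) unfolding stage_strategies_def by simp
qed

lemma set_stage_draw:
  assumes "bayes_game G" "\<And>i. \<sigma> i \<in> strategies G i k" "k \<le> l" "l \<le> horizon G"
    "x \<in> states G l" "\<theta> \<in> types G i"
  shows "set_pmf (stage_draw G \<sigma> i l x \<theta>) \<subseteq>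
    types G (opp i) \<times> actions G P1 l \<times> actions G P2 l"
proof -
  have b: "set_pmf (belief G i l x \<theta>) \<subseteq> types G (opp i)"
    by (rule belief_support[OF assms(1,4-6)])
  have s: "set_pmf (\<sigma> p l x (pairing i \<theta> \<theta>' p)) \<subseteq> actions G p l"
    if "\<theta>' \<in> set_pmf (belief G i l x \<theta>)" for p \<theta>'
    using strategies_support[OF assms(2-5) pairing_in_types[OF assms(6) subsetD[OF b that]]] .
  show ?thesis
  proof
    fix z assume "z \<in> set_pmf (stage_draw G \<sigma> i l x \<theta>)"
    then obtain \<theta>' a1 a2 where z: "z = (\<theta>', a1, a2)" "\<theta>' \<in> set_pmf (belief G i l x \<theta>)"
      "a1 \<in> set_pmf (\<sigma> P1 l x (pairing i \<theta> \<theta>' P1))" "a2 \<in> set_pmf (\<sigma> P2 l x (pairing i \<theta> \<theta>' P2))"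
      unfolding stage_draw_def by (auto simp: set_bind_pmf)
    show "z \<in> types G (opp i) \<times> actions G P1 l \<times> actions G P2 l"
      using z(1) subsetD[OF b z(2)] subsetD[OF s[OF z(2)] z(3)] subsetD[OF s[OF z(2)] z(4)]
      by simp
  qed
qed

lemma finite_stage_draw:
  assumes "bayes_game G" "\<And>i. \<sigma> i \<in> strategies G i k" "k \<le> l" "l \<le> horizon G"
    "x \<in> states G l" "\<theta> \<in> types G i"
  shows "finite (set_pmf (stage_draw G \<sigma> i l x \<theta>))"
proof (rule finite_subset[OF set_stage_draw[OF assms]])
  show "finite (types G (opp i) \<times> actions G P1 l \<times> actions G P2 l)"
    using finite_types[OF assms(1)] finite_actions[OF assms(1,4)] by simp
qed

lemma expectation_stage_draw:
  fixes G :: "('x, 't, 'a) bayes_game" and g :: "'t \<Rightarrow> 'a \<Rightarrow> 'a \<Rightarrow> real"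
  assumes "bayes_game G" "\<And>i. \<sigma> i \<in> strategies G i k" "k \<le> l" "l \<le> horizon G"
    "x \<in> states G l" "\<theta> \<in> types G i"
  shows "measure_pmf.expectation (stage_draw G \<sigma> i l x \<theta>) (\<lambda>(\<theta>', a1, a2). g \<theta>' a1 a2) =
    (\<Sum>\<theta>'\<in>types G (opp i). pmf (belief G i l x \<theta>) \<theta>' *
      (\<Sum>a1\<in>actions G P1 l. pmf (\<sigma> P1 l x (pairing i \<theta> \<theta>' P1)) a1 *
        (\<Sum>a2\<in>actions G P2 l. pmf (\<sigma> P2 l x (pairing i \<theta> \<theta>' P2)) a2 * g \<theta>' a1 a2)))"
proof -
  have b: "set_pmf (belief G i l x \<theta>) \<subseteq> types G (opp i)"
    by (rule belief_support[OF assms(1,4-6)])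
  have fT: "finite (types G (opp i))" and fA: "finite (actions G p l)" for p
    by (rule finite_types[OF assms(1)], rule finite_actions[OF assms(1,4)])
  have s: "set_pmf (\<sigma> p l x (pairing i \<theta> \<theta>' p)) \<subseteq> actions G p l"
    if "\<theta>' \<in> types G (opp i)" for p \<theta>'
    using strategies_support[OF assms(2-5) pairing_in_types[OF assms(6) that]] .
  define D2 :: "'t \<Rightarrow> 'a \<Rightarrow> ('t \<times> 'a \<times> 'a) pmf" where "D2 \<theta>' a1 = bind_pmf (\<sigma> P2 l x (pairing i \<theta> \<theta>' P2))
     (\<lambda>a2. return_pmf (\<theta>', a1, a2))" for \<theta>' a1
  define D1 where "D1 \<theta>' = bind_pmf (\<sigma> P1 l x (pairing i \<theta> \<theta>' P1)) (D2 \<theta>')" for \<theta>'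
  define h where "h = (\<lambda>(\<theta>', a1, a2). g \<theta>' a1 a2)"
  have fs: "finite (set_pmf (\<sigma> p l x (pairing i \<theta> \<theta>' p)))" if "\<theta>' \<in> types G (opp i)" for p \<theta>'
    using finite_subset[OF s[OF that] fA] .
  have f2: "finite (set_pmf (D2 \<theta>' a1))" if "\<theta>' \<in> types G (opp i)" for \<theta>' a1
    unfolding D2_def using fs[OF that] by (simp add: set_bind_pmf)
  have f1: "finite (set_pmf (D1 \<theta>'))" if "\<theta>' \<in> types G (opp i)" for \<theta>'
    unfolding D1_def using fs[OF that] f2[OF that] by (simp add: set_bind_pmf)
  have e2: "measure_pmf.expectation (D2 \<theta>' a1) h =
      (\<Sum>a2\<in>actions G P2 l. pmf (\<sigma> P2 l x (pairing i \<theta> \<theta>' P2)) a2 * g \<theta>' a1 a2)"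
    if "\<theta>' \<in> types G (opp i)" for \<theta>' a1
    unfolding D2_def by (subst pmf_expectation_bind[OF fA _ s[OF that]]) (simp_all add: h_def)
  have e1: "measure_pmf.expectation (D1 \<theta>') h =
      (\<Sum>a1\<in>actions G P1 l. pmf (\<sigma> P1 l x (pairing i \<theta> \<theta>' P1)) a1 *
        (\<Sum>a2\<in>actions G P2 l. pmf (\<sigma> P2 l x (pairing i \<theta> \<theta>' P2)) a2 * g \<theta>' a1 a2))"
    if "\<theta>' \<in> types G (opp i)" for \<theta>'
    unfolding D1_def
    by (subst pmf_expectation_bind[OF fA _ s[OF that]]) (simp_all add: e2[OF that] f2[OF that])
  have "measure_pmf.expectation (bind_pmf (belief G i l x \<theta>) D1) h =
    (\<Sum>\<theta>'\<in>types G (opp i). pmf (belief G i l x \<theta>) \<theta>' * measure_pmf.expectation (D1 \<theta>') h)"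
    by (subst pmf_expectation_bind[OF fT f1 b]) simp_all
  moreover have "stage_draw G \<sigma> i l x \<theta> = bind_pmf (belief G i l x \<theta>) D1"
    unfolding stage_draw_def D1_def D2_def ..
  ultimately show ?thesis
    unfolding h_def[symmetric] by (simp add: e1)
qed

lemma set_next_state:
  assumes "bayes_game G" "\<And>i. \<sigma> i \<in> strategies G i k" "k \<le> l" "l < horizon G"
    "x \<in> states G l" "\<theta> \<in> types G i"
  shows "set_pmf (next_state G \<sigma> i l x \<theta>) \<subseteq> states G (Suc l)"
proof -
  have tr: "\<forall>a1\<in>actions G P1 l. \<forall>a2\<in>actions G P2 l. transition G l x a1 a2 \<in> states G (Suc l)"
    using trans_in_states[OF assms(1,4,5)] by simp
  have "transition G l x a1 a2 \<in> states G (Suc l)"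
    if "(\<theta>', a1, a2) \<in> set_pmf (stage_draw G \<sigma> i l x \<theta>)" for \<theta>' a1 a2
    using subsetD[OF set_stage_draw[OF assms(1-3) less_imp_le[OF assms(4)] assms(5,6)] that] tr
    by auto
  thus ?thesis unfolding next_state_def by auto
qed

lemma finite_next_state:
  assumes "bayes_game G" "\<And>i. \<sigma> i \<in> strategies G i k" "k \<le> l" "l < horizon G"
    "x \<in> states G l" "\<theta> \<in> types G i"
  shows "finite (set_pmf (next_state G \<sigma> i l x \<theta>))"
  using finite_stage_draw[OF assms(1-3) less_imp_le[OF assms(4)] assms(5,6)]
  unfolding next_state_def by simp

lemma state_law_support:
  assumes "bayes_game G" "\<And>i. \<sigma> i \<in> strategies G i k" "k \<le> l" "l + d \<le> horizon G"
    "x \<in> states G l" "\<theta> \<in> types G i"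
  shows "set_pmf (state_law G \<sigma> i l x \<theta> d) \<subseteq> states G (l + d) \<and>
    finite (set_pmf (state_law G \<sigma> i l x \<theta> d))"
  using assms(4)
proof (induction d)
  case 0
  then show ?case using assms(5) by simp
next
  case (Suc d)
  hence IH: "set_pmf (state_law G \<sigma> i l x \<theta> d) \<subseteq> states G (l + d)"
    "finite (set_pmf (state_law G \<sigma> i l x \<theta> d))" by auto
  have kl: "k \<le> l + d" "l + d < horizon G" using Suc.prems assms(3) by auto
  note * = set_next_state[OF assms(1,2) kl _ assms(6)] finite_next_state[OF assms(1,2) kl _ assms(6)]
  show ?case
  proof
    show "set_pmf (state_law G \<sigma> i l x \<theta> (Suc d)) \<subseteq> states G (l + Suc d)"
    proof
      fix z assume "z \<in> set_pmf (state_law G \<sigma> i l x \<theta> (Suc d))"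
      then obtain y where y: "y \<in> set_pmf (state_law G \<sigma> i l x \<theta> d)"
        "z \<in> set_pmf (next_state G \<sigma> i (l + d) y \<theta>)"
        by (auto simp: set_bind_pmf)
      show "z \<in> states G (l + Suc d)"
        using subsetD[OF *(1)[OF subsetD[OF IH(1) y(1)]] y(2)] by simp
    qed
    show "finite (set_pmf (state_law G \<sigma> i l x \<theta> (Suc d)))"
      using IH(2) *(2)[OF subsetD[OF IH(1)]] by (simp add: set_bind_pmf)
  qed
qed

lemma state_law_Suc_front:
  "state_law G \<sigma> i k x \<theta> (Suc d) =
     bind_pmf (next_state G \<sigma> i k x \<theta>) (\<lambda>y. state_law G \<sigma> i (Suc k) y \<theta> d)"
proof (induction d)
  case 0
  then show ?case by (simp add: bind_return_pmf bind_return_pmf')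
next
  case (Suc d)
  show ?case
    by (subst state_law.simps(2), subst Suc.IH) (simp add: bind_assoc_pmf)
qed

lemma expectation_bind_finite:
  fixes p :: "'b pmf" and f :: "'b \<Rightarrow> 'c pmf" and h :: "'c \<Rightarrow> real"
  assumes "finite (set_pmf p)" "\<And>z. z \<in> set_pmf p \<Longrightarrow> finite (set_pmf (f z))"
  shows "measure_pmf.expectation (bind_pmf p f) h =
    measure_pmf.expectation p (\<lambda>z. measure_pmf.expectation (f z) h)"
proof -
  have "measure_pmf.expectation (bind_pmf p f) h =
      (\<Sum>z\<in>set_pmf p. pmf p z *\<^sub>R measure_pmf.expectation (f z) h)"
    by (rule pmf_expectation_bind[OF assms order_refl])
  also have "\<dots> = measure_pmf.expectation p (\<lambda>z. measure_pmf.expectation (f z) h)"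
    by (rule integral_measure_pmf[OF assms(1), symmetric])
  finally show ?thesis .
qed

lemma utility_beyond_horizon [simp]: "utility G \<sigma> i (Suc (horizon G)) x \<theta> = 0"
  by (simp add: utility_def)

text \<open>The recursive form of the expected cumulative utility.\<close>

theorem utility_rec:
  fixes G :: "('x, 't, 'a) bayes_game"
  assumes G: "bayes_game G" and \<sigma>: "\<And>i. \<sigma> i \<in> strategies G i k" and k: "k \<le> horizon G"
    and x: "x \<in> states G k" and \<theta>: "\<theta> \<in> types G i"
  shows "utility G \<sigma> i k x \<theta> =
    (\<Sum>\<theta>'\<in>types G (opp i). pmf (belief G i k x \<theta>) \<theta>' *
      (\<Sum>a1\<in>actions G P1 k. pmf (\<sigma> P1 k x (pairing i \<theta> \<theta>' P1)) a1 *
        (\<Sum>a2\<in>actions G P2 k. pmf (\<sigma> P2 k x (pairing i \<theta> \<theta>' P2)) a2 *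
          (payoff G i k x a1 a2 (pairing i \<theta> \<theta>' P1) (pairing i \<theta> \<theta>' P2) +
           utility G \<sigma> i (Suc k) (transition G k x a1 a2) \<theta>))))"
proof -
  let ?D = "stage_draw G \<sigma> i k x \<theta>"
  let ?E = "measure_pmf.expectation"
  define P where "P = (\<lambda>(\<theta>', a1, a2). payoff G i k x a1 a2 (pairing i \<theta> \<theta>' P1) (pairing i \<theta> \<theta>' P2))"
  define T where "T = (\<lambda>(\<theta>' :: 't, a1, a2). transition G k x a1 a2)"
  have fD: "finite (set_pmf ?D)"
    by (rule finite_stage_draw[OF G \<sigma> order_refl k x \<theta>])
  have int: "integrable (measure_pmf ?D) h" for h :: "_ \<Rightarrow> real"
    by (rule integrable_measure_pmf_finite[OF fD])
  have later: "?E (state_law G \<sigma> i k x \<theta> (l - k)) (\<lambda>y. stage_utility G \<sigma> i l y \<theta>) =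
      ?E ?D (\<lambda>z. ?E (state_law G \<sigma> i (Suc k) (T z) \<theta> (l - Suc k)) (\<lambda>y. stage_utility G \<sigma> i l y \<theta>))"
    if l: "l \<in> {Suc k..horizon G}" for l
  proof -
    have kK: "k < horizon G" using l by simp
    have fin: "finite (set_pmf (state_law G \<sigma> i (Suc k) (T z) \<theta> (l - Suc k)))"
      if z: "z \<in> set_pmf ?D" for z
    proof -
      have "T z \<in> set_pmf (next_state G \<sigma> i k x \<theta>)"
        using z unfolding next_state_def T_def by auto
      hence "T z \<in> states G (Suc k)"
        using set_next_state[OF G \<sigma> order_refl kK x \<theta>] by blast
      thus ?thesis
        using state_law_support[OF G \<sigma>, of "Suc k" "l - Suc k" "T z" \<theta> i] l \<theta> by auto
    qed
    have "state_law G \<sigma> i k x \<theta> (l - k) = state_law G \<sigma> i k x \<theta> (Suc (l - Suc k))"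
      using l by (simp add: Suc_diff_Suc)
    also have "\<dots> = bind_pmf ?D (\<lambda>z. state_law G \<sigma> i (Suc k) (T z) \<theta> (l - Suc k))"
      by (subst state_law_Suc_front) (simp add: next_state_def T_def bind_map_pmf)
    finally show ?thesis
      using expectation_bind_finite[OF fD fin] by simp
  qed
  have "utility G \<sigma> i k x \<theta> = stage_utility G \<sigma> i k x \<theta> +
      (\<Sum>l = Suc k..horizon G. ?E (state_law G \<sigma> i k x \<theta> (l - k)) (\<lambda>y. stage_utility G \<sigma> i l y \<theta>))"
    unfolding utility_def using k by (subst sum.atLeast_Suc_atMost) simp_all
  also have "\<dots> = ?E ?D P + ?E ?D (\<lambda>z. utility G \<sigma> i (Suc k) (T z) \<theta>)"
    unfolding utility_def stage_utility_def[of G \<sigma> i k x] P_def[symmetric]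
    by (subst Bochner_Integration.integral_sum[OF int]) (simp add: later)
  also have "\<dots> = ?E ?D (\<lambda>z. P z + utility G \<sigma> i (Suc k) (T z) \<theta>)"
    by (rule Bochner_Integration.integral_add[OF int int, symmetric])
  also have "(\<lambda>z. P z + utility G \<sigma> i (Suc k) (T z) \<theta>) =
      (\<lambda>(\<theta>', a1, a2). payoff G i k x a1 a2 (pairing i \<theta> \<theta>' P1) (pairing i \<theta> \<theta>' P2) +
        utility G \<sigma> i (Suc k) (transition G k x a1 a2) \<theta>)"
    by (auto simp: P_def T_def)
  finally show ?thesis
    by (simp add: expectation_stage_draw[OF G \<sigma> order_refl k x \<theta>])
qed

definition DBNE :: "('x, 't, 'a) bayes_game \<Rightarrow> (player \<Rightarrow> ('x, 't, 'a) strategy) \<Rightarrow> bool" where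
  "DBNE G \<sigma> \<longleftrightarrow>
     (\<forall>i. \<sigma> i \<in> strategies G i 0) \<and>
     (\<forall>k\<le>horizon G. \<forall>x\<in>states G k. \<forall>i. \<forall>\<theta>\<in>types G i. \<forall>\<rho>\<in>strategies G i k.
        utility G \<sigma> i k x \<theta> \<ge> utility G (\<sigma>(i := \<rho>)) i k x \<theta>)"

definition SBNE_final ::
    "('x, 't, 'a) bayes_game \<Rightarrow> (player \<Rightarrow> ('x, 't, 'a) strategy) \<Rightarrow> 'x \<Rightarrow> bool" where
  "SBNE_final G \<sigma> x \<longleftrightarrow>
     (let K = horizon G in
       (\<forall>i. \<sigma> i K \<in> stage_strategies G i K) \<and>
       (\<forall>i. \<forall>\<theta>\<in>types G i. \<forall>\<rho>\<in>stage_strategies G i K.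
          utility G \<sigma> i K x \<theta> \<ge> utility G (\<sigma>(i := (\<sigma> i)(K := \<rho>))) i K x \<theta>))"

text \<open>
  The optimization problem at stage \<open>k\<close> and state \<open>x\<close>.  The variables are the local strategies
  \<open>\<tau> i \<theta>\<close> and the numbers \<open>s i \<theta>\<close>; the profile \<open>\<sigma>\<close> enters only through its continuation
  utilities from stage \<open>Suc k\<close> on.
\<close>

definition total_payoff ::
    "('x, 't, 'a) bayes_game \<Rightarrow> (player \<Rightarrow> ('x, 't, 'a) strategy) \<Rightarrow> player \<Rightarrow> nat \<Rightarrow> 'x
      \<Rightarrow> 'a \<Rightarrow> 'a \<Rightarrow> (player \<Rightarrow> 't) \<Rightarrow> real" where
  "total_payoff G \<sigma> i k x a1 a2 t =
     payoff G i k x a1 a2 (t P1) (t P2) + utility G \<sigma> i (Suc k) (transition G k x a1 a2) (t i)"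

definition objective ::
    "('x, 't, 'a) bayes_game \<Rightarrow> (player \<Rightarrow> 't \<Rightarrow> real) \<Rightarrow> (player \<Rightarrow> ('x, 't, 'a) strategy)
      \<Rightarrow> nat \<Rightarrow> 'x \<Rightarrow> (player \<Rightarrow> 't \<Rightarrow> 'a pmf) \<Rightarrow> (player \<Rightarrow> 't \<Rightarrow> real) \<Rightarrow> real" where
  "objective G \<alpha> \<sigma> k x \<tau> s =
     (\<Sum>i\<in>{P1, P2}. \<Sum>\<theta>\<in>types G i. \<alpha> i \<theta> *
        (s i \<theta> +
         (\<Sum>\<theta>'\<in>types G (opp i). pmf (belief G i k x \<theta>) \<theta>' *
           (\<Sum>a1\<in>actions G P1 k. pmf (\<tau> P1 (pairing i \<theta> \<theta>' P1)) a1 *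
             (\<Sum>a2\<in>actions G P2 k. pmf (\<tau> P2 (pairing i \<theta> \<theta>' P2)) a2 *
               total_payoff G \<sigma> i k x a1 a2 (pairing i \<theta> \<theta>'))))))"

definition feasible ::
    "('x, 't, 'a) bayes_game \<Rightarrow> (player \<Rightarrow> ('x, 't, 'a) strategy)
      \<Rightarrow> nat \<Rightarrow> 'x \<Rightarrow> (player \<Rightarrow> 't \<Rightarrow> 'a pmf) \<Rightarrow> (player \<Rightarrow> 't \<Rightarrow> real) \<Rightarrow> bool" where
  "feasible G \<sigma> k x \<tau> s \<longleftrightarrow>
     (\<forall>i. \<forall>\<theta>\<in>types G i. set_pmf (\<tau> i \<theta>) \<subseteq> actions G i k) \<and>
     (\<forall>\<theta>2\<in>types G P2. \<forall>a2\<in>actions G P2 k.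
        (\<Sum>\<theta>1\<in>types G P1. pmf (belief G P2 k x \<theta>2) \<theta>1 *
          (\<Sum>a1\<in>actions G P1 k. pmf (\<tau> P1 \<theta>1) a1 *
            total_payoff G \<sigma> P2 k x a1 a2 (pairing P1 \<theta>1 \<theta>2))) \<le> - s P2 \<theta>2) \<and>
     (\<forall>\<theta>1\<in>types G P1. \<forall>a1\<in>actions G P1 k.
        (\<Sum>\<theta>2\<in>types G P2. pmf (belief G P1 k x \<theta>1) \<theta>2 *
          (\<Sum>a2\<in>actions G P2 k. pmf (\<tau> P2 \<theta>2) a2 *
            total_payoff G \<sigma> P1 k x a1 a2 (pairing P1 \<theta>1 \<theta>2))) \<le> - s P1 \<theta>1)"

definition optimal ::
    "('x, 't, 'a) bayes_game \<Rightarrow> (player \<Rightarrow> 't \<Rightarrow> real) \<Rightarrow> (player \<Rightarrow> ('x, 't, 'a) strategy)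
      \<Rightarrow> nat \<Rightarrow> 'x \<Rightarrow> (player \<Rightarrow> 't \<Rightarrow> 'a pmf) \<Rightarrow> (player \<Rightarrow> 't \<Rightarrow> real) \<Rightarrow> bool" where
  "optimal G \<alpha> \<sigma> k x \<tau> s \<longleftrightarrow>
     feasible G \<sigma> k x \<tau> s \<and>
     (\<forall>\<tau>' s'. feasible G \<sigma> k x \<tau>' s' \<longrightarrow> objective G \<alpha> \<sigma> k x \<tau>' s' \<le> objective G \<alpha> \<sigma> k x \<tau> s)"

text \<open>
  The profile \<open>\<sigma>\<close> with the behaviour in state \<open>x\<close> at stage \<open>k\<close> replaced by \<open>\<tau>\<close>.
\<close>

definition replace_at ::
    "(player \<Rightarrow> ('x, 't, 'a) strategy) \<Rightarrow> nat \<Rightarrow> 'x \<Rightarrow> (player \<Rightarrow> 't \<Rightarrow> 'a pmf)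
      \<Rightarrow> player \<Rightarrow> ('x, 't, 'a) strategy" where
  "replace_at \<sigma> k x \<tau> = (\<lambda>i. (\<sigma> i)(k := (\<sigma> i k)(x := \<tau> i)))"

end

(*
  With continuation utilities fixed, the objective of the stage problem is a sum, with positive
  weights, of terms s + (expected payoff), and the constraints say that no pure action earns more
  than -s.  Hence the objective is nonpositive on feasible points and vanishes exactly when every
  -s equals the expected payoff, that is, when the local strategies form a Bayesian Nash
  equilibrium of the stage game.  Such an equilibrium exists by Brouwer's fixed point theorem
  applied to Nash's map, so optimal solutions are exactly the stage equilibria with tight s.
  Backward induction (the one-shot deviation principle) links stage equilibria with DBNE.
*)
theory Submission
  imports Defs
begin

subsection \<open>Brouwer's theorem on cubes over a finite index set\<close>

text \<open>
  The library version of the theorem fixes the dimension by a type.  Here the index set is a term,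
  and Kuhn's lemma, whose dimension is a natural number, is applied directly.
\<close>

definition unit_cube_on :: "'i set \<Rightarrow> ('i \<Rightarrow> real) set" where
  "unit_cube_on I = {x. (\<forall>i\<in>I. 0 \<le> x i \<and> x i \<le> 1) \<and> (\<forall>i. i \<notin> I \<longrightarrow> x i = 0)}"

lemma tendsto_fun_iff:
  fixes f :: "'c \<Rightarrow> 'i \<Rightarrow> 'b::topological_space"
  shows "(f \<longlongrightarrow> l) F \<longleftrightarrow> (\<forall>i. ((\<lambda>c. f c i) \<longlongrightarrow> l i) F)"
  using limitin_componentwise[of "\<lambda>_. euclidean" UNIV f l F]
  by (simp add: euclidean_product_topology)

text \<open>Bolzano-Weierstrass, one coordinate at a time: thinning the subsequence for a new
  coordinate keeps the limits of the earlier ones.\<close>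

lemma bounded_coordinates_subseq:
  fixes q :: "nat \<Rightarrow> 'i \<Rightarrow> real"
  assumes "finite I" and "\<And>m i. i \<in> I \<Longrightarrow> q m i \<in> {0..1}"
  shows "\<exists>r. strict_mono r \<and> (\<forall>i\<in>I. convergent (\<lambda>m. q (r m) i))"
  using assms
proof (induction I rule: finite_induct)
  case empty
  then show ?case using strict_mono_id by blast
next
  case (insert j I)
  then obtain r where r: "strict_mono r" "\<forall>i\<in>I. convergent (\<lambda>m. q (r m) i)"
    by auto
  obtain l t where t: "strict_mono (t :: nat \<Rightarrow> nat)" "((\<lambda>m. q (r m) j) \<circ> t) \<longlonglongrightarrow> l"
    using insert.prems[of j] seq_compactE[OF compact_imp_seq_compact[OF compact_Icc]]
    by (metis insertI1)
  have "convergent (\<lambda>m. q ((r \<circ> t) m) i)" if "i \<in> insert j I" for i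
  proof (cases "i = j")
    case True
    then show ?thesis using t by (auto simp: convergent_def o_def)
  next
    case False
    then have "convergent (\<lambda>m. q (r m) i)" using r that by auto
    from convergent_subseq_convergent[OF this t(1)] show ?thesis by (simp add: o_def)
  qed
  then show ?case using strict_mono_o[OF r(1) t(1)] by blast
qed

text \<open>Kuhn's lemma on the grid of mesh \<open>1 / p\<close>. A label tells whether
  \<open>f\<close> pushes a coordinate up or down, and within one grid cell at \<open>q\<close>
  every coordinate receives both labels. The points \<open>u\<close> and \<open>v\<close> may differ
  from coordinate to coordinate.\<close>

lemma kuhn_almost_fixed:
  fixes f :: "('i \<Rightarrow> real) \<Rightarrow> 'i \<Rightarrow> real"
  assumes fin: "finite I"
    and f: "\<And>x i. x \<in> unit_cube_on I \<Longrightarrow> i \<in> I \<Longrightarrow> f x i \<in> {0..1}"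
    and p: "p > 0"
  shows "\<exists>q\<in>unit_cube_on I. \<forall>i\<in>I. \<exists>u\<in>unit_cube_on I. \<exists>v\<in>unit_cube_on I.
    (\<forall>j\<in>I. \<bar>u j - q j\<bar> \<le> 1 / real p) \<and> (\<forall>j\<in>I. \<bar>v j - q j\<bar> \<le> 1 / real p) \<and>
    u i \<le> f u i \<and> f v i \<le> v i"
proof -
  define n where "n = card I"
  obtain h where h: "bij_betw h {..<n} I"
    using ex_bij_betw_nat_finite[OF fin] by (auto simp: n_def atLeast0LessThan)
  define g where "g = inv_into {..<n} h"
  have g: "g i < n" "h (g i) = i" if "i \<in> I" for i
    using h that unfolding g_def bij_betw_def
    by (metis inv_into_into lessThan_iff, metis f_inv_into_f)
  have hI: "h j \<in> I" "g (h j) = j" if "j < n" for j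
    using h that unfolding g_def bij_betw_def by auto
  define P where "P x = (\<lambda>i. if i \<in> I then real (x (g i)) / p else 0)" for x :: "nat \<Rightarrow> nat"
  have P: "P x \<in> unit_cube_on I" if "\<forall>i<n. x i \<le> p" for x
    using that g p by (auto simp: P_def unit_cube_on_def)
  \<comment> \<open>Kuhn's lemma prescribes the labels on the faces. They agree with the direction
    of \<open>f\<close> there, because \<open>f\<close> takes values in the unit interval.\<close>
  define label where "label x j = (if x j = 0 then 0 else if x j = p then 1
      else if P x (h j) \<le> f (P x) (h j) then 0 else 1 :: nat)" for x j
  obtain q where q: "\<forall>i<n. q i < p"
    and q': "\<forall>i<n. \<exists>r s. (\<forall>j<n. q j \<le> r j \<and> r j \<le> q j + 1) \<and>
      (\<forall>j<n. q j \<le> s j \<and> s j \<le> q j + 1) \<and> label r i \<noteq> label s i"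
  proof (rule kuhn_lemma[OF p, of n label])
    show "\<forall>x. (\<forall>i<n. x i \<le> p) \<longrightarrow> (\<forall>i<n. label x i = 0 \<or> label x i = 1)"
      "\<forall>x. (\<forall>i<n. x i \<le> p) \<longrightarrow> (\<forall>i<n. x i = 0 \<longrightarrow> label x i = 0)"
      "\<forall>x. (\<forall>i<n. x i \<le> p) \<longrightarrow> (\<forall>i<n. x i = p \<longrightarrow> label x i = 1)"
      using p by (auto simp: label_def)
  qed blast
  have near: "\<bar>P r j - P q j\<bar> \<le> 1 / real p"
    if "\<forall>j<n. q j \<le> r j \<and> r j \<le> q j + 1" "j \<in> I" for r j
  proof -
    have "q (g j) \<le> r (g j)" "r (g j) \<le> q (g j) + 1" using that g by auto
    then have "real (r (g j)) - real (q (g j)) \<in> {0..1}" by auto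
    then have "(real (r (g j)) - real (q (g j))) / p \<in> {0..1 / p}" by (auto intro: divide_right_mono)
    then show ?thesis using that(2) by (simp add: P_def diff_divide_distrib)
  qed
  have "\<exists>u\<in>unit_cube_on I. \<exists>v\<in>unit_cube_on I.
    (\<forall>j\<in>I. \<bar>u j - P q j\<bar> \<le> 1 / real p) \<and> (\<forall>j\<in>I. \<bar>v j - P q j\<bar> \<le> 1 / real p) \<and>
    u i \<le> f u i \<and> f v i \<le> v i" if i: "i \<in> I" for i
  proof -
    have lab: "(label r (g i) = 0 \<and> P r i \<le> f (P r) i) \<or> (label r (g i) = 1 \<and> f (P r) i \<le> P r i)"
      if "P r \<in> unit_cube_on I" for r
    proof -
      have "P r i = real (r (g i)) / p" using i by (simp add: P_def)
      then show ?thesis using f[OF that i] g[OF i] p by (auto simp: label_def)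
    qed
    obtain r s where rs: "\<forall>j<n. q j \<le> r j \<and> r j \<le> q j + 1" "\<forall>j<n. q j \<le> s j \<and> s j \<le> q j + 1"
      "label r (g i) \<noteq> label s (g i)"
      using q' g(1)[OF i] by blast
    \<comment> \<open>The strict bound \<open>q i < p\<close> leaves room for the step of size 1, so
      the whole cell stays in the grid.\<close>
    have cube: "P r \<in> unit_cube_on I" "P s \<in> unit_cube_on I"
      using rs q by (auto intro!: P) (meson Suc_leI le_trans)+
    have nr: "\<forall>j\<in>I. \<bar>P r j - P q j\<bar> \<le> 1 / real p" and ns: "\<forall>j\<in>I. \<bar>P s j - P q j\<bar> \<le> 1 / real p"
      using near[OF rs(1)] near[OF rs(2)] by blast+
    from lab[OF cube(1)] lab[OF cube(2)] rs(3)
    have "(P r i \<le> f (P r) i \<and> f (P s) i \<le> P s i) \<or> (P s i \<le> f (P s) i \<and> f (P r) i \<le> P r i)"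
      by auto
    then show ?thesis using cube nr ns by blast
  qed
  moreover have "P q \<in> unit_cube_on I" using q by (intro P) auto
  ultimately show ?thesis by blast
qed

text \<open>Refine the grid and pass to a limit \<open>x\<close> of the points \<open>q\<close>. The
  witnesses \<open>u\<close> and \<open>v\<close> tend to the same \<open>x\<close>, and by
  continuity their opposite inequalities become \<open>x i \<le> f x i\<close> and
  \<open>f x i \<le> x i\<close>.\<close>

theorem brouwer_unit_cube_on:
  fixes f :: "('i \<Rightarrow> real) \<Rightarrow> 'i \<Rightarrow> real"
  assumes fin: "finite I"
    and f: "\<And>x i. x \<in> unit_cube_on I \<Longrightarrow> i \<in> I \<Longrightarrow> f x i \<in> {0..1}"
    and cont: "\<And>i. i \<in> I \<Longrightarrow> continuous_on (unit_cube_on I) (\<lambda>x. f x i)"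
  obtains x where "x \<in> unit_cube_on I" "\<And>i. i \<in> I \<Longrightarrow> f x i = x i"
proof -
  define Q where "Q m q i u v \<longleftrightarrow> u \<in> unit_cube_on I \<and> v \<in> unit_cube_on I \<and>
    (\<forall>j\<in>I. \<bar>u j - q j\<bar> \<le> 1 / real (Suc m)) \<and> (\<forall>j\<in>I. \<bar>v j - q j\<bar> \<le> 1 / real (Suc m)) \<and>
    u i \<le> f u i \<and> f v i \<le> v i" for m q i u v
  have "\<exists>q\<in>unit_cube_on I. \<forall>i\<in>I. \<exists>u v. Q m q i u v" for m
    using kuhn_almost_fixed[OF fin, of f "Suc m"] f unfolding Q_def by blast
  then obtain q where q: "\<And>m. q m \<in> unit_cube_on I"
    and "\<forall>m. \<forall>i\<in>I. \<exists>u v. Q m (q m) i u v" by metis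
  then obtain u v where Q: "\<And>m i. i \<in> I \<Longrightarrow> Q m (q m) i (u m i) (v m i)" by metis
  have
    u: "\<And>m i. i \<in> I \<Longrightarrow> u m i \<in> unit_cube_on I"
       "\<And>m i j. i \<in> I \<Longrightarrow> j \<in> I \<Longrightarrow> \<bar>u m i j - q m j\<bar> \<le> 1 / real (Suc m)"
       "\<And>m i. i \<in> I \<Longrightarrow> u m i i \<le> f (u m i) i"
    and v: "\<And>m i. i \<in> I \<Longrightarrow> v m i \<in> unit_cube_on I"
       "\<And>m i j. i \<in> I \<Longrightarrow> j \<in> I \<Longrightarrow> \<bar>v m i j - q m j\<bar> \<le> 1 / real (Suc m)"
       "\<And>m i. i \<in> I \<Longrightarrow> f (v m i) i \<le> v m i i"
    using Q unfolding Q_def by blast+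
  obtain r where r: "strict_mono r" "\<forall>i\<in>I. convergent (\<lambda>m. q (r m) i)"
    using bounded_coordinates_subseq[OF fin, of q] q by (auto simp: unit_cube_on_def)
  define x where "x = (\<lambda>i. if i \<in> I then lim (\<lambda>m. q (r m) i) else 0)"
  have qx: "(\<lambda>m. q (r m) i) \<longlonglongrightarrow> x i" if "i \<in> I" for i
    using r(2) that by (simp add: x_def convergent_LIMSEQ_iff)
  have x: "x \<in> unit_cube_on I"
  proof -
    have "0 \<le> x i \<and> x i \<le> 1" if "i \<in> I" for i
      using LIMSEQ_le_const[OF qx[OF that], of 0] LIMSEQ_le_const2[OF qx[OF that], of 1] q that
      by (auto simp: unit_cube_on_def)
    then show ?thesis by (auto simp: unit_cube_on_def x_def)
  qed
  have small: "(\<lambda>m. 1 / real (Suc (r m))) \<longlonglongrightarrow> 0"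
    using LIMSEQ_subseq_LIMSEQ[OF LIMSEQ_inverse_real_of_nat r(1)]
    by (simp add: o_def inverse_eq_divide)
  \<comment> \<open>Stated for any sequence \<open>w\<close> shadowing \<open>q\<close>, so that it
    serves \<open>u\<close> and \<open>v\<close> at every coordinate.\<close>
  have conv: "(\<lambda>m. w (r m)) \<longlonglongrightarrow> x"
    if w: "\<And>m. w m \<in> unit_cube_on I" "\<And>m j. j \<in> I \<Longrightarrow> \<bar>w m j - q m j\<bar> \<le> 1 / real (Suc m)"
    for w :: "nat \<Rightarrow> 'i \<Rightarrow> real"
    unfolding tendsto_fun_iff
  proof
    fix j
    show "(\<lambda>m. w (r m) j) \<longlonglongrightarrow> x j"
    proof (cases "j \<in> I")
      case True
      have "(\<lambda>m. w (r m) j - q (r m) j) \<longlonglongrightarrow> 0"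
        by (rule Lim_null_comparison[OF _ small]) (use w(2)[OF True] in auto)
      from tendsto_add[OF this qx[OF True]] show ?thesis by simp
    next
      case False
      then show ?thesis using w(1) by (simp add: unit_cube_on_def x_def)
    qed
  qed
  have fconv: "(\<lambda>m. f (w (r m)) i) \<longlonglongrightarrow> f x i"
    if "i \<in> I" "\<And>m. w m \<in> unit_cube_on I"
      "\<And>m j. j \<in> I \<Longrightarrow> \<bar>w m j - q m j\<bar> \<le> 1 / real (Suc m)"
    for w :: "nat \<Rightarrow> 'i \<Rightarrow> real" and i
    by (rule continuous_on_tendsto_compose[OF cont[OF that(1)] conv x]) (use that in auto)
  have "f x i = x i" if i: "i \<in> I" for i
  proof (rule antisym)
    show "f x i \<le> x i"
      using LIMSEQ_le[OF fconv[of i "\<lambda>m. v m i"] conv[of "\<lambda>m. v m i", unfolded tendsto_fun_iff, rule_format, of i]]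
        i v by blast
    show "x i \<le> f x i"
      using LIMSEQ_le[OF conv[of "\<lambda>m. u m i", unfolded tendsto_fun_iff, rule_format, of i] fconv[of i "\<lambda>m. u m i"]]
        i u by blast
  qed
  with x that show ?thesis by blast
qed

subsection \<open>Nash equilibria in agent form\<close>

text \<open>Nash's argument. \<open>u n a y\<close> is what agent \<open>n\<close> earns with the
  pure action \<open>a\<close> against the profile \<open>y\<close>. Profiles are real functions on
  pairs, so that the fixed point theorem on cubes applies to them.\<close>

theorem agent_form_equilibrium:
  fixes A :: "'n \<Rightarrow> 'b set" and u :: "'n \<Rightarrow> 'b \<Rightarrow> ('n \<times> 'b \<Rightarrow> real) \<Rightarrow> real"
  assumes finN: "finite N" and finA: "\<And>n. n \<in> N \<Longrightarrow> finite (A n)"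
    and neA: "\<And>n. n \<in> N \<Longrightarrow> A n \<noteq> {}"
    and cont: "\<And>n a. n \<in> N \<Longrightarrow> a \<in> A n \<Longrightarrow> continuous_on UNIV (u n a)"
  obtains y where "\<And>n a. 0 \<le> y (n, a)" "\<And>n. n \<in> N \<Longrightarrow> (\<Sum>a\<in>A n. y (n, a)) = 1"
    "\<And>n a. n \<in> N \<Longrightarrow> a \<in> A n \<Longrightarrow> u n a y \<le> (\<Sum>b\<in>A n. y (n, b) * u n b y)"
proof -
  define I where "I = Sigma N A"
  have finI: "finite I" using finN finA by (auto simp: I_def)
  define S where "S x n = (\<Sum>a\<in>A n. x (n, a))" for x :: "'n \<times> 'b \<Rightarrow> real" and n
  \<comment> \<open>Retraction of the cube onto the product of the simplices.\<close>
  define g where "g x = (\<lambda>(n, a). if (n, a) \<in> I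
      then (x (n, a) + max 0 (1 - S x n) / card (A n)) / max 1 (S x n) else 0)"
    for x :: "'n \<times> 'b \<Rightarrow> real"
  \<comment> \<open>\<open>\<phi>\<close> is the gain of a pure action over the mean, cut off at 0.
    \<open>f\<close> is Nash's map preceded by the retraction, which makes it defined on the whole
    cube.\<close>
  define \<phi> where "\<phi> y n a = max 0 (u n a y - (\<Sum>b\<in>A n. y (n, b) * u n b y))" for y n a
  define f where "f x = (\<lambda>(n, a). (g x (n, a) + \<phi> (g x) n a) / (1 + (\<Sum>b\<in>A n. \<phi> (g x) n b)))" for x
  have g_ge0: "0 \<le> g x (n, a)" if "x \<in> unit_cube_on I" for x n a
    using that by (auto simp: g_def unit_cube_on_def)
  have g_sum: "(\<Sum>a\<in>A n. g x (n, a)) = 1" if "n \<in> N" for x n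
  proof -
    have "(\<Sum>a\<in>A n. g x (n, a)) = (\<Sum>a\<in>A n. (x (n, a) + max 0 (1 - S x n) / card (A n)) / max 1 (S x n))"
      using that by (intro sum.cong) (auto simp: g_def I_def)
    also have "\<dots> = (S x n + max 0 (1 - S x n)) / max 1 (S x n)"
      using finA[OF that] neA[OF that]
      by (simp add: sum_divide_distrib[symmetric] sum.distrib S_def)
    also have "\<dots> = 1" by (auto simp: max_def)
    finally show ?thesis .
  qed
  have \<phi>_ge0: "0 \<le> \<phi> y n a" for y n a by (simp add: \<phi>_def)
  have \<Phi>_ge0: "0 \<le> (\<Sum>b\<in>A n. \<phi> y n b)" for y n by (simp add: sum_nonneg \<phi>_ge0)
  have f_sum: "(\<Sum>a\<in>A n. f x (n, a)) = 1" if "n \<in> N" for x n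
    using g_sum[OF that, of x] \<Phi>_ge0[where y = "g x" and n = n]
    by (simp add: f_def sum_divide_distrib[symmetric] sum.distrib)
  have f_ge0: "0 \<le> f x (n, a)" if "x \<in> unit_cube_on I" for x n a
    using g_ge0[OF that] \<phi>_ge0 \<Phi>_ge0[where n = n] by (auto simp: f_def)
  have f_le1: "f x (n, a) \<le> 1" if "x \<in> unit_cube_on I" "n \<in> N" "a \<in> A n" for x n a
    using member_le_sum[of a "A n" "\<lambda>a. f x (n, a)"] f_sum[OF that(2)] f_ge0[OF that(1)] finA that
    by auto
  have contS: "continuous_on T (\<lambda>x. S x n)" for T n
    unfolding S_def by (intro continuous_intros continuous_on_subset[OF continuous_on_product_coordinates]) auto
  have contg: "continuous_on T (\<lambda>x. g x k)" for T k
  proof (cases "k \<in> I")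
    case True
    then have "card (A (fst k)) \<noteq> 0" using finA neA by (force simp: I_def card_eq_0_iff)
    with True show ?thesis unfolding g_def
      by (cases k) (auto intro!: continuous_intros contS continuous_on_subset[OF continuous_on_product_coordinates])
  qed (cases k, simp add: g_def)
  have contu: "continuous_on T (\<lambda>x. u n a (g x))" if "n \<in> N" "a \<in> A n" for T n a
    by (rule continuous_on_compose2[OF cont[OF that]])
       (auto intro!: continuous_on_coordinatewise_then_product contg)
  have cont\<phi>: "continuous_on T (\<lambda>x. \<phi> (g x) n a)" if "n \<in> N" "a \<in> A n" for T n a
    unfolding \<phi>_def using that by (auto intro!: continuous_intros contu contg)
  have contf: "continuous_on T (\<lambda>x. f x k)" if "k \<in> I" for T k
  proof -
    obtain n a where k: "k = (n, a)" "n \<in> N" "a \<in> A n" using \<open>k \<in> I\<close> by (auto simp: I_def)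
    have "1 + (\<Sum>b\<in>A n. \<phi> (g x) n b) \<noteq> 0" for x using \<Phi>_ge0[where y = "g x" and n = n] by simp
    then show ?thesis unfolding k f_def using k
      by (auto intro!: continuous_intros contg cont\<phi>)
  qed
  obtain x where x: "x \<in> unit_cube_on I" "\<And>k. k \<in> I \<Longrightarrow> f x k = x k"
  proof (rule brouwer_unit_cube_on[OF finI, of f])
    show "f x i \<in> {0..1}" if "x \<in> unit_cube_on I" "i \<in> I" for x i
      using that f_ge0 f_le1 by (cases i) (auto simp: I_def)
  qed (use contf in auto)
  \<comment> \<open>A fixed point is a value of \<open>f\<close>, hence already a profile of
    distributions, and the retraction leaves it alone.\<close>
  have Sx: "S x n = 1" if "n \<in> N" for n
  proof -
    have "S x n = (\<Sum>a\<in>A n. f x (n, a))"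
      unfolding S_def using that by (intro sum.cong) (auto simp: x(2) I_def)
    then show ?thesis using f_sum[OF that] by simp
  qed
  have gx: "g x = x"
  proof
    fix k
    show "g x k = x k"
      using x(1) Sx by (cases k) (auto simp: g_def I_def unit_cube_on_def)
  qed
  have "u n a x \<le> (\<Sum>b\<in>A n. x (n, b) * u n b x)" if n: "n \<in> N" and a: "a \<in> A n" for n a
  proof -
    define U where "U = (\<Sum>b\<in>A n. x (n, b) * u n b x)"
    define \<Phi> where "\<Phi> = (\<Sum>b\<in>A n. \<phi> x n b)"
    have pos: "0 \<le> \<Phi>" using \<Phi>_ge0 by (simp add: \<Phi>_def)
    \<comment> \<open>The fixed point equation of Nash's map with the denominator cleared.\<close>
    have eq: "x (n, b) * \<Phi> = \<phi> x n b" if "b \<in> A n" for b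
    proof -
      have "x (n, b) = (x (n, b) + \<phi> x n b) / (1 + \<Phi>)"
        using x(2)[of "(n, b)"] that n gx by (simp add: f_def I_def \<Phi>_def)
      then show ?thesis using pos by (simp add: field_simps)
    qed
    \<comment> \<open>Some action in the support does no better than the average; its excess is zero.\<close>
    have "\<exists>b\<in>A n. x (n, b) > 0 \<and> u n b x \<le> U"
    proof (rule ccontr)
      assume "\<not> ?thesis"
      then have less: "x (n, b) > 0 \<Longrightarrow> U < u n b x" if "b \<in> A n" for b using that by force
      have x0: "0 \<le> x (n, b)" if "b \<in> A n" for b using x(1) that n by (auto simp: unit_cube_on_def I_def)
      have "\<exists>b\<in>A n. x (n, b) > 0"
        using Sx[OF n] sum_nonpos[of "A n" "\<lambda>b. x (n, b)"] unfolding S_def by force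
      \<comment> \<open>If every action in the support beat the mean \<open>U\<close>, the weighted
        mean, with weights of total 1, would exceed itself.\<close>
      then have "(\<Sum>b\<in>A n. x (n, b) * U) < (\<Sum>b\<in>A n. x (n, b) * u n b x)"
      proof (intro sum_strict_mono_ex1[OF finA[OF n]] ballI)
        show "x (n, b) * U \<le> x (n, b) * u n b x" if "b \<in> A n" for b
          using less[OF that] x0[OF that] by (cases "x (n, b) = 0") auto
        show "\<exists>b\<in>A n. x (n, b) * U < x (n, b) * u n b x"
          using \<open>\<exists>b\<in>A n. x (n, b) > 0\<close> less by (metis mult_strict_left_mono)
      qed
      then show False using Sx[OF n] by (simp add: U_def S_def sum_distrib_right[symmetric])
    qed
    then obtain b where "b \<in> A n" "x (n, b) > 0" "u n b x \<le> U" by auto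
    \<comment> \<open>An action of positive weight with excess 0 forces the total excess to vanish,
      and with it every single excess.\<close>
    then have "\<Phi> = 0" using eq[of b] by (simp add: \<phi>_def U_def)
    then have "\<phi> x n a = 0" using eq[OF a] by simp
    then show ?thesis by (simp add: \<phi>_def max_def split: if_splits)
  qed
  moreover have "0 \<le> x (n, a)" for n a using g_ge0[OF x(1)] gx by simp
  ultimately show ?thesis using that[of x] Sx by (simp add: S_def)
qed

subsection \<open>The stage game\<close>

lemma all_player: "(\<forall>i. P i) \<longleftrightarrow> P P1 \<and> P P2"
  by (metis player.exhaust)

lemma pairing_same [simp]: "pairing i u v i = u"
  by (simp add: pairing_def)

lemma pairing_commute: "pairing P2 u v = pairing P1 v u"
proof
  show "pairing P2 u v p = pairing P1 v u p" for p by (cases p) (auto simp: pairing_def)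
qed

text \<open>The left-hand sides of constraints (a) and (b) in one formula; \<open>pairing\<close>
  puts the arguments back into the order of the players. Of \<open>\<tau>\<close> only the
  opponent's component enters.\<close>

definition pure_payoff ::
    "('x, 't, 'a) bayes_game \<Rightarrow> (player \<Rightarrow> ('x, 't, 'a) strategy) \<Rightarrow> nat \<Rightarrow> 'x
      \<Rightarrow> (player \<Rightarrow> 't \<Rightarrow> 'a pmf) \<Rightarrow> player \<Rightarrow> 't \<Rightarrow> 'a \<Rightarrow> real" where
  "pure_payoff G \<sigma> k x \<tau> i \<theta> a =
     (\<Sum>\<theta>'\<in>types G (opp i). pmf (belief G i k x \<theta>) \<theta>' *
       (\<Sum>a'\<in>actions G (opp i) k. pmf (\<tau> (opp i) \<theta>') a' *
         total_payoff G \<sigma> i k x (pairing i a a' P1) (pairing i a a' P2) (pairing i \<theta> \<theta>')))"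

definition mixed_payoff ::
    "('x, 't, 'a) bayes_game \<Rightarrow> (player \<Rightarrow> ('x, 't, 'a) strategy) \<Rightarrow> nat \<Rightarrow> 'x
      \<Rightarrow> (player \<Rightarrow> 't \<Rightarrow> 'a pmf) \<Rightarrow> player \<Rightarrow> 't \<Rightarrow> real" where
  "mixed_payoff G \<sigma> k x \<tau> i \<theta> =
     (\<Sum>a\<in>actions G i k. pmf (\<tau> i \<theta>) a * pure_payoff G \<sigma> k x \<tau> i \<theta> a)"

definition local_strategies ::
    "('x, 't, 'a) bayes_game \<Rightarrow> nat \<Rightarrow> (player \<Rightarrow> 't \<Rightarrow> 'a pmf) set" where
  "local_strategies G k = {\<tau>. \<forall>i. \<forall>\<theta>\<in>types G i. set_pmf (\<tau> i \<theta>) \<subseteq> actions G i k}"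

text \<open>Testing pure actions, type by type, suffices: a mixed deviation earns an average of pure
  payoffs.\<close>

definition stage_equilibrium ::
    "('x, 't, 'a) bayes_game \<Rightarrow> (player \<Rightarrow> ('x, 't, 'a) strategy) \<Rightarrow> nat \<Rightarrow> 'x
      \<Rightarrow> (player \<Rightarrow> 't \<Rightarrow> 'a pmf) \<Rightarrow> bool" where
  "stage_equilibrium G \<sigma> k x \<tau> \<longleftrightarrow> \<tau> \<in> local_strategies G k \<and>
     (\<forall>i. \<forall>\<theta>\<in>types G i. \<forall>a\<in>actions G i k.
        pure_payoff G \<sigma> k x \<tau> i \<theta> a \<le> mixed_payoff G \<sigma> k x \<tau> i \<theta>)"

lemma sum_pull_weight:
  fixes p :: "'b \<Rightarrow> real"
  shows "(\<Sum>t\<in>T. b t * (\<Sum>a\<in>A. p a * F t a)) = (\<Sum>a\<in>A. p a * (\<Sum>t\<in>T. b t * F t a))"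
  unfolding sum_distrib_left by (subst sum.swap) (simp add: mult_ac)

text \<open>The player's own mixture does not depend on the opponent's type, so the sum over the own
  action can be moved outermost.\<close>

lemma mixed_payoff_eq:
  "(\<Sum>\<theta>'\<in>types G (opp i). pmf (belief G i k x \<theta>) \<theta>' *
      (\<Sum>a1\<in>actions G P1 k. pmf (\<tau> P1 (pairing i \<theta> \<theta>' P1)) a1 *
        (\<Sum>a2\<in>actions G P2 k. pmf (\<tau> P2 (pairing i \<theta> \<theta>' P2)) a2 *
          total_payoff G \<sigma> i k x a1 a2 (pairing i \<theta> \<theta>')))) = mixed_payoff G \<sigma> k x \<tau> i \<theta>"
proof (cases i)
  case P1
  then show ?thesis
    by (simp add: mixed_payoff_def pure_payoff_def pairing_def) (rule sum_pull_weight)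
next
  case P2
  \<comment> \<open>For \<open>P2\<close> the own sum is innermost: it first passes the sum over
    \<open>a1\<close>, then the one over types.\<close>
  have "(\<Sum>a1\<in>actions G P1 k. pmf (\<tau> P1 \<theta>') a1 * (\<Sum>a2\<in>actions G P2 k. pmf (\<tau> P2 \<theta>) a2 * F a1 a2)) =
    (\<Sum>a2\<in>actions G P2 k. pmf (\<tau> P2 \<theta>) a2 * (\<Sum>a1\<in>actions G P1 k. pmf (\<tau> P1 \<theta>') a1 * F a1 a2))"
    for F \<theta>' by (rule sum_pull_weight)
  with P2 show ?thesis
    by (simp add: mixed_payoff_def pure_payoff_def pairing_def) (rule sum_pull_weight)
qed

section \<open>The optimization problem in terms of stage payoffs\<close>

lemma objective_eq:
  "objective G \<alpha> \<sigma> k x \<tau> s =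
     (\<Sum>i\<in>{P1, P2}. \<Sum>\<theta>\<in>types G i. \<alpha> i \<theta> * (s i \<theta> + mixed_payoff G \<sigma> k x \<tau> i \<theta>))"
  unfolding objective_def mixed_payoff_eq ..

lemma feasible_iff:
  "feasible G \<sigma> k x \<tau> s \<longleftrightarrow> \<tau> \<in> local_strategies G k \<and>
     (\<forall>i. \<forall>\<theta>\<in>types G i. \<forall>a\<in>actions G i k. pure_payoff G \<sigma> k x \<tau> i \<theta> a \<le> - s i \<theta>)"
  unfolding feasible_def local_strategies_def
  by (simp add: all_player pure_payoff_def pairing_commute pairing_def) blast

lemma mixed_payoff_le:
  assumes G: "bayes_game G" "k \<le> horizon G" and \<tau>: "set_pmf (\<tau> i \<theta>) \<subseteq> actions G i k"
    and le: "\<And>a. a \<in> actions G i k \<Longrightarrow> pure_payoff G \<sigma> k x \<tau> i \<theta> a \<le> c"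
  shows "mixed_payoff G \<sigma> k x \<tau> i \<theta> \<le> c"
proof -
  have "mixed_payoff G \<sigma> k x \<tau> i \<theta> \<le> (\<Sum>a\<in>actions G i k. pmf (\<tau> i \<theta>) a * c)"
    unfolding mixed_payoff_def using le by (intro sum_mono mult_left_mono) auto
  also have "\<dots> = c"
    using sum_pmf_eq_1[OF finite_actions[OF G] \<tau>] by (simp add: sum_distrib_right[symmetric])
  finally show ?thesis .
qed

text \<open>By feasibility each \<open>s i \<theta>\<close> plus the mixed payoff is at most 0, an
  average of pure payoffs being at most \<open>- s i \<theta>\<close>. With positive weights the sum
  vanishes only if every term does.\<close>

lemma objective_nonpos:
  assumes G: "bayes_game G" "k \<le> horizon G" and pos: "\<And>i \<theta>. \<theta> \<in> types G i \<Longrightarrow> \<alpha> i \<theta> > 0"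
    and feas: "feasible G \<sigma> k x \<tau> s"
  shows "objective G \<alpha> \<sigma> k x \<tau> s \<le> 0"
    and "objective G \<alpha> \<sigma> k x \<tau> s = 0 \<longleftrightarrow> (\<forall>i. \<forall>\<theta>\<in>types G i. s i \<theta> = - mixed_payoff G \<sigma> k x \<tau> i \<theta>)"
proof -
  have le: "\<alpha> i \<theta> * (s i \<theta> + mixed_payoff G \<sigma> k x \<tau> i \<theta>) \<le> 0" if "\<theta> \<in> types G i" for i \<theta>
  proof -
    have "mixed_payoff G \<sigma> k x \<tau> i \<theta> \<le> - s i \<theta>"
      using feas that by (intro mixed_payoff_le[OF G]) (auto simp: feasible_iff local_strategies_def)
    then show ?thesis using pos[OF that] by (simp add: mult_le_0_iff)
  qed
  let ?S = "\<lambda>i. \<Sum>\<theta>\<in>types G i. \<alpha> i \<theta> * (s i \<theta> + mixed_payoff G \<sigma> k x \<tau> i \<theta>)"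
  have S: "?S i \<le> 0" for i by (rule sum_nonpos) (rule le)
  have S0: "?S i = 0 \<longleftrightarrow> (\<forall>\<theta>\<in>types G i. s i \<theta> = - mixed_payoff G \<sigma> k x \<tau> i \<theta>)" for i
  proof -
    have "?S i = 0 \<longleftrightarrow> (\<forall>\<theta>\<in>types G i. \<alpha> i \<theta> * (s i \<theta> + mixed_payoff G \<sigma> k x \<tau> i \<theta>) = 0)"
      using sum_nonneg_eq_0_iff[OF finite_types[OF G(1)],
        of i "\<lambda>\<theta>. - (\<alpha> i \<theta> * (s i \<theta> + mixed_payoff G \<sigma> k x \<tau> i \<theta>))"] le
      by (simp only: sum_negf neg_0_le_iff_le neg_equal_0_iff_equal)
    also have "\<dots> \<longleftrightarrow> (\<forall>\<theta>\<in>types G i. s i \<theta> = - mixed_payoff G \<sigma> k x \<tau> i \<theta>)"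
      using pos by (intro ball_cong) (auto simp: eq_neg_iff_add_eq_0 less_le)
    finally show ?thesis .
  qed
  have obj: "objective G \<alpha> \<sigma> k x \<tau> s = ?S P1 + ?S P2" by (simp add: objective_eq)
  show "objective G \<alpha> \<sigma> k x \<tau> s \<le> 0" using S[of P1] S[of P2] unfolding obj by simp
  show "objective G \<alpha> \<sigma> k x \<tau> s = 0 \<longleftrightarrow> (\<forall>i. \<forall>\<theta>\<in>types G i. s i \<theta> = - mixed_payoff G \<sigma> k x \<tau> i \<theta>)"
    using S[of P1] S[of P2] unfolding obj all_player S0[symmetric] by linarith
qed

section \<open>One-shot deviations and backward induction\<close>

lemma utility_eq_mixed_payoff:
  assumes "bayes_game G" "\<And>i. \<sigma> i \<in> strategies G i k" "k \<le> horizon G"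
    "x \<in> states G k" "\<theta> \<in> types G i"
  shows "utility G \<sigma> i k x \<theta> = mixed_payoff G \<sigma> k x (\<lambda>p. \<sigma> p k x) i \<theta>"
  by (simp add: utility_rec[OF assms] mixed_payoff_eq[symmetric] total_payoff_def)

text \<open>Changes before stage \<open>k\<close> are invisible from \<open>k\<close> on. Hence a
  deviation at one stage leaves the continuation utilities, and so the stage game, as they
  were.\<close>

lemma utility_cong:
  assumes "\<And>p l. k \<le> l \<Longrightarrow> l \<le> horizon G \<Longrightarrow> \<sigma> p l = \<sigma>' p l"
  shows "utility G \<sigma> i k x \<theta> = utility G \<sigma>' i k x \<theta>"
proof -
  have draw: "stage_draw G \<sigma> i l y \<theta> = stage_draw G \<sigma>' i l y \<theta>" if "k \<le> l" "l \<le> horizon G" for l y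
    using assms[OF that] by (simp add: stage_draw_def)
  have law: "state_law G \<sigma> i k x \<theta> d = state_law G \<sigma>' i k x \<theta> d" if "k + d \<le> horizon G" for d
    using that by (induction d) (simp_all add: next_state_def draw)
  show ?thesis
    unfolding utility_def stage_utility_def by (intro sum.cong) (auto simp: draw law)
qed

lemma mixed_payoff_cong:
  assumes "\<And>y. utility G \<sigma> i (Suc k) y \<theta> = utility G \<sigma>' i (Suc k) y \<theta>"
    and "\<tau> i \<theta> = \<tau>' i \<theta>" "\<tau> (opp i) = \<tau>' (opp i)"
  shows "mixed_payoff G \<sigma> k x \<tau> i \<theta> = mixed_payoff G \<sigma>' k x \<tau>' i \<theta>"
  using assms by (simp add: mixed_payoff_def pure_payoff_def total_payoff_def)

text \<open>Probabilities are nonnegative and transitions stay in the state sets, so the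
  continuation utilities need comparing only on \<open>states G (Suc k)\<close>.\<close>

lemma pure_payoff_mono:
  assumes G: "bayes_game G" "k < horizon G" "x \<in> states G k"
    and le: "\<And>y. y \<in> states G (Suc k) \<Longrightarrow> utility G \<sigma> i (Suc k) y \<theta> \<le> utility G \<sigma>' i (Suc k) y \<theta>"
    and \<tau>: "\<tau> (opp i) = \<tau>' (opp i)" and a: "a \<in> actions G i k"
  shows "pure_payoff G \<sigma> k x \<tau> i \<theta> a \<le> pure_payoff G \<sigma>' k x \<tau>' i \<theta> a"
proof -
  have "transition G k x (pairing i a a' P1) (pairing i a a' P2) \<in> states G (Suc k)"
    if "a' \<in> actions G (opp i) k" for a'
    using that a by (cases i) (auto simp: pairing_def intro!: trans_in_states[OF G])
  then show ?thesis
    unfolding pure_payoff_def total_payoff_def \<tau>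
    by (intro sum_mono mult_left_mono add_left_mono) (auto intro: le)
qed

lemma replace_at_strategies:
  assumes "\<And>i. \<sigma> i \<in> strategies G i m" "\<tau> \<in> local_strategies G k"
  shows "replace_at \<sigma> k x \<tau> i \<in> strategies G i m"
  using assms(1)[of i] assms(2)
  by (auto simp: strategies_def Pi_def stage_strategies_def replace_at_def local_strategies_def)

lemma strategies_antimono: "k \<le> l \<Longrightarrow> strategies G i k \<subseteq> strategies G i l"
  by (auto simp: strategies_def Pi_def)

lemma utility_replace_at:
  assumes "bayes_game G" "\<And>i. \<sigma> i \<in> strategies G i k" "k \<le> horizon G"
    "x \<in> states G k" "\<theta> \<in> types G i" "\<tau> \<in> local_strategies G k"
  shows "utility G (replace_at \<sigma> k x \<tau>) i k x \<theta> = mixed_payoff G \<sigma> k x \<tau> i \<theta>"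
proof -
  have "utility G (replace_at \<sigma> k x \<tau>) i (Suc k) y \<theta> = utility G \<sigma> i (Suc k) y \<theta>" for y
    by (rule utility_cong) (simp add: replace_at_def)
  then show ?thesis
    unfolding utility_eq_mixed_payoff[OF assms(1) replace_at_strategies[OF assms(2,6)] assms(3-5)]
    by (intro mixed_payoff_cong) (auto simp: replace_at_def)
qed

text \<open>A profitable pure action of one type in the stage game would be a profitable deviation
  in the whole game: play it once and follow \<open>\<sigma>\<close> otherwise.\<close>

lemma DBNE_imp_stage_equilibrium:
  assumes G: "bayes_game G" and DBNE: "DBNE G \<sigma>" and k: "k \<le> horizon G" and x: "x \<in> states G k"
  shows "stage_equilibrium G \<sigma> k x (\<lambda>i. \<sigma> i k x)"
proof -
  have strat: "\<sigma> i \<in> strategies G i k" for i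
    using DBNE strategies_antimono[of 0 k] by (auto simp: DBNE_def)
  have loc: "(\<lambda>i. \<sigma> i k x) \<in> local_strategies G k"
    unfolding local_strategies_def using strategies_support[of \<sigma> G k k x, OF strat] k x by blast
  have "pure_payoff G \<sigma> k x (\<lambda>i. \<sigma> i k x) i \<theta> a \<le> mixed_payoff G \<sigma> k x (\<lambda>i. \<sigma> i k x) i \<theta>"
    if \<theta>: "\<theta> \<in> types G i" and a: "a \<in> actions G i k" for i \<theta> a
  proof -
    \<comment> \<open>Only type \<open>\<theta>\<close> of player \<open>i\<close> departs from
      \<open>\<sigma>\<close>, playing \<open>a\<close> with certainty.\<close>
    define \<tau> where "\<tau> = (\<lambda>i. \<sigma> i k x)(i := (\<sigma> i k x)(\<theta> := return_pmf a))"
    have \<tau>: "\<tau> \<in> local_strategies G k" using loc a by (auto simp: \<tau>_def local_strategies_def)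
    \<comment> \<open>Brings the local change into the form of a unilateral deviation, as
      \<open>DBNE\<close> requires.\<close>
    have upd: "replace_at \<sigma> k x \<tau> = \<sigma>(i := replace_at \<sigma> k x \<tau> i)"
      by (auto simp: replace_at_def \<tau>_def fun_eq_iff)
    have "utility G (replace_at \<sigma> k x \<tau>) i k x \<theta> \<le> utility G \<sigma> i k x \<theta>"
      using DBNE k x \<theta> replace_at_strategies[OF strat \<tau>] upd unfolding DBNE_def by metis
    then have "mixed_payoff G \<sigma> k x \<tau> i \<theta> \<le> mixed_payoff G \<sigma> k x (\<lambda>i. \<sigma> i k x) i \<theta>"
      by (simp add: utility_replace_at[OF G strat k x \<theta> \<tau>] utility_eq_mixed_payoff[OF G strat k x \<theta>])
    \<comment> \<open>The opponent's component is untouched, so the pure payoffs are those against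
      \<open>\<sigma>\<close>; the point mass then selects the one of \<open>a\<close>.\<close>
    moreover have "opp i \<noteq> i" by (cases i) auto
    then have "mixed_payoff G \<sigma> k x \<tau> i \<theta> = (\<Sum>b\<in>actions G i k. indicator {b} a *
        pure_payoff G \<sigma> k x (\<lambda>i. \<sigma> i k x) i \<theta> b)"
      by (simp add: mixed_payoff_def pure_payoff_def \<tau>_def)
    then have "mixed_payoff G \<sigma> k x \<tau> i \<theta> = pure_payoff G \<sigma> k x (\<lambda>i. \<sigma> i k x) i \<theta> a"
      using a finite_actions[OF G k] by (simp add: indicator_def if_distrib[of "\<lambda>c. c * _"] sum.delta')
    ultimately show ?thesis by simp
  qed
  with loc show ?thesis by (auto simp: stage_equilibrium_def)
qed

text \<open>Backward induction. A deviator's continuation utilities are bounded by those of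
  \<open>\<sigma>\<close>, and against the latter no action at the current stage beats the
  equilibrium value.\<close>

lemma stage_equilibrium_imp_DBNE:
  assumes G: "bayes_game G" and strat0: "\<And>i. \<sigma> i \<in> strategies G i 0"
    and final: "\<And>x. x \<in> states G (horizon G) \<Longrightarrow> SBNE_final G \<sigma> x"
    and eq: "\<And>k x. k < horizon G \<Longrightarrow> x \<in> states G k \<Longrightarrow> stage_equilibrium G \<sigma> k x (\<lambda>i. \<sigma> i k x)"
  shows "DBNE G \<sigma>"
proof -
  have strat: "\<sigma> i \<in> strategies G i k" for i k
    using strat0[of i] strategies_antimono[of 0 k] by auto
  have "utility G (\<sigma>(i := \<rho>)) i k x \<theta> \<le> utility G \<sigma> i k x \<theta>"
    if "k \<le> horizon G" "x \<in> states G k" "\<theta> \<in> types G i" "\<rho> \<in> strategies G i k" for i k x \<theta> \<rho>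
    using that
  proof (induction k arbitrary: x rule: inc_induct)
    case base
    have "\<rho> (horizon G) \<in> stage_strategies G i (horizon G)"
      using base by (auto simp: strategies_def)
    then have "utility G (\<sigma>(i := (\<sigma> i)(horizon G := \<rho> (horizon G)))) i (horizon G) x \<theta>
        \<le> utility G \<sigma> i (horizon G) x \<theta>"
      using final[of x] base by (auto simp: SBNE_final_def Let_def)
    \<comment> \<open>\<open>SBNE_final\<close> alters the last stage only, and the utility from the
      horizon on sees nothing else of \<open>\<rho>\<close>.\<close>
    moreover have "utility G (\<sigma>(i := (\<sigma> i)(horizon G := \<rho> (horizon G)))) i (horizon G) x \<theta> =
        utility G (\<sigma>(i := \<rho>)) i (horizon G) x \<theta>"
      by (rule utility_cong) auto
    ultimately show ?case by metis
  next
    case (step k)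
    let ?\<tau> = "\<lambda>p. (\<sigma>(i := \<rho>)) p k x"
    have strat': "(\<sigma>(i := \<rho>)) p \<in> strategies G p k" for p
      using strat step.prems by auto
    have IH: "utility G (\<sigma>(i := \<rho>)) i (Suc k) y \<theta> \<le> utility G \<sigma> i (Suc k) y \<theta>"
      if "y \<in> states G (Suc k)" for y
      using step.IH[OF that step.prems(2)] step.prems(3) strategies_antimono[of k "Suc k" G i]
      by (metis le_SucI order_refl subsetD)
    have "opp i \<noteq> i" by (cases i) auto
    \<comment> \<open>Two bounds are chained: first the induction hypothesis replaces the deviator's
      continuation by that of \<open>\<sigma>\<close>, then the stage equilibrium bounds the pure
      payoff.\<close>
    then have "pure_payoff G (\<sigma>(i := \<rho>)) k x ?\<tau> i \<theta> a \<le> utility G \<sigma> i k x \<theta>"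
      if a: "a \<in> actions G i k" for a
      using pure_payoff_mono[OF G step.hyps(2) step.prems(1) IH, of ?\<tau> "\<lambda>p. \<sigma> p k x" a] a
        eq[OF step.hyps(2) step.prems(1)] step
        utility_eq_mixed_payoff[OF G strat, of k x \<theta> i]
      by (force simp: stage_equilibrium_def)
    moreover have "set_pmf (?\<tau> i \<theta>) \<subseteq> actions G i k"
      using strategies_support[of "\<sigma>(i := \<rho>)" G k k x \<theta> i, OF strat'] step by auto
    ultimately have "mixed_payoff G (\<sigma>(i := \<rho>)) k x ?\<tau> i \<theta> \<le> utility G \<sigma> i k x \<theta>"
      using step.hyps by (intro mixed_payoff_le[OF G]) auto
    moreover have "utility G (\<sigma>(i := \<rho>)) i k x \<theta> = mixed_payoff G (\<sigma>(i := \<rho>)) k x ?\<tau> i \<theta>"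
      by (rule utility_eq_mixed_payoff[OF G strat']) (use step in auto)
    ultimately show ?case by argo
  qed
  then show ?thesis using strat0 by (auto simp: DBNE_def)
qed

section \<open>Existence of stage equilibria\<close>

lemma pmf_of_finite_weights:
  fixes f :: "'a \<Rightarrow> real"
  assumes "finite A" "\<And>a. a \<in> A \<Longrightarrow> 0 \<le> f a" "(\<Sum>a\<in>A. f a) = 1"
  shows "\<exists>p. set_pmf p \<subseteq> A \<and> (\<forall>a\<in>A. pmf p a = f a)"
proof -
  \<comment> \<open>\<open>embed_pmf\<close> expects weights on the whole type; the value 0 off
    \<open>A\<close> also confines the support to \<open>A\<close>.\<close>
  define g where "g a = (if a \<in> A then f a else 0)" for a
  have nonneg: "0 \<le> g a" for a using assms(2) by (simp add: g_def)
  have "(\<integral>\<^sup>+a. ennreal (g a) \<partial>count_space UNIV) = (\<Sum>a\<in>A. ennreal (g a))"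
    using assms(1) by (intro nn_integral_count_space') (auto simp: g_def)
  also have "\<dots> = ennreal (\<Sum>a\<in>A. g a)" using nonneg by (simp add: sum_ennreal)
  also have "(\<Sum>a\<in>A. g a) = 1" using assms(3) by (simp add: g_def)
  finally have prob: "(\<integral>\<^sup>+a. ennreal (g a) \<partial>count_space UNIV) = 1" by simp
  have "set_pmf (embed_pmf g) \<subseteq> A" by (auto simp: set_embed_pmf[OF nonneg prob] g_def split: if_splits)
  moreover have "pmf (embed_pmf g) a = f a" if "a \<in> A" for a
    using that by (simp add: pmf_embed_pmf[OF nonneg prob] g_def)
  ultimately show ?thesis by blast
qed

text \<open>
  Beliefs need not come from a common prior, so each type of each player is treated as a separate
  agent.
\<close>

lemma stage_equilibrium_exists:
  fixes G :: "('x, 't, 'a) bayes_game"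
  assumes G: "bayes_game G" and k: "k \<le> horizon G"
  shows "\<exists>\<tau>. stage_equilibrium G \<sigma> k x \<tau>"
proof -
  define A where "A = (\<lambda>(i :: player, \<theta> :: 't). actions G i k)"
  \<comment> \<open>This is \<open>pure_payoff\<close> with probabilities replaced by free real
    coordinates, hence continuous on the whole function space.\<close>
  define u where "u = (\<lambda>(i, \<theta>) a (y :: (player \<times> 't) \<times> 'a \<Rightarrow> real).
    \<Sum>\<theta>'\<in>types G (opp i). pmf (belief G i k x \<theta>) \<theta>' *
       (\<Sum>a'\<in>actions G (opp i) k. y ((opp i, \<theta>'), a') *
         total_payoff G \<sigma> i k x (pairing i a a' P1) (pairing i a a' P2) (pairing i \<theta> \<theta>')))"
  have player: "(UNIV :: player set) = {P1, P2}" using player.exhaust by blast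
  have finN: "finite (Sigma UNIV (types G))"
    using finite_types[OF G] by (intro finite_SigmaI) (simp_all add: player)
  have act: "finite (actions G i k)" "actions G i k \<noteq> {}" for i
    using G k by (auto simp: bayes_game_def)
  have cont: "continuous_on UNIV (u n a)" for n a
    unfolding u_def by (cases n) (auto intro!: continuous_intros)
  obtain y where y: "\<And>n a. 0 \<le> y (n, a)"
    "\<And>n. n \<in> Sigma UNIV (types G) \<Longrightarrow> (\<Sum>a\<in>A n. y (n, a)) = 1"
    "\<And>n a. n \<in> Sigma UNIV (types G) \<Longrightarrow> a \<in> A n \<Longrightarrow> u n a y \<le> (\<Sum>b\<in>A n. y (n, b) * u n b y)"
  proof (rule agent_form_equilibrium[OF finN, of A u])
    show "finite (A n)" "A n \<noteq> {}" for n using act by (cases n, simp add: A_def)+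
  qed (use cont in blast)+
  have "\<forall>i. \<forall>\<theta>\<in>types G i. \<exists>p. set_pmf p \<subseteq> actions G i k \<and> (\<forall>a\<in>actions G i k. pmf p a = y ((i, \<theta>), a))"
  proof (intro allI ballI)
    fix i \<theta> assume "\<theta> \<in> types G i"
    then show "\<exists>p. set_pmf p \<subseteq> actions G i k \<and> (\<forall>a\<in>actions G i k. pmf p a = y ((i, \<theta>), a))"
      using y(1) y(2)[of "(i, \<theta>)"] by (intro pmf_of_finite_weights act(1)) (auto simp: A_def)
  qed
  then obtain \<tau> where
    "\<forall>i. \<forall>\<theta>\<in>types G i. set_pmf (\<tau> i \<theta>) \<subseteq> actions G i k \<and> (\<forall>a\<in>actions G i k. pmf (\<tau> i \<theta>) a = y ((i, \<theta>), a))"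
    unfolding bchoice_iff choice_iff by blast
  then have \<tau>: "\<And>i \<theta>. \<theta> \<in> types G i \<Longrightarrow> set_pmf (\<tau> i \<theta>) \<subseteq> actions G i k"
    "\<And>i \<theta> a. \<theta> \<in> types G i \<Longrightarrow> a \<in> actions G i k \<Longrightarrow> pmf (\<tau> i \<theta>) a = y ((i, \<theta>), a)"
    by blast+
  have u_eq: "u (i, \<theta>) a y = pure_payoff G \<sigma> k x \<tau> i \<theta> a" for i \<theta> a
    by (simp add: u_def pure_payoff_def \<tau>(2))
  have "pure_payoff G \<sigma> k x \<tau> i \<theta> a \<le> mixed_payoff G \<sigma> k x \<tau> i \<theta>"
    if "\<theta> \<in> types G i" "a \<in> actions G i k" for i \<theta> a
    using y(3)[of "(i, \<theta>)" a] that by (simp add: A_def u_eq mixed_payoff_def \<tau>(2))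
  then have "stage_equilibrium G \<sigma> k x \<tau>"
    using \<tau>(1) by (auto simp: stage_equilibrium_def local_strategies_def)
  then show ?thesis by (rule exI[of _ \<tau>])
qed

section \<open>Optimal solutions as tight stage equilibria\<close>

text \<open>The objective is at most 0 on feasible points, and an equilibrium with its tight
  \<open>s\<close> attains 0. So optimal means feasible with value 0, which forces
  tightness.\<close>

lemma optimal_iff:
  assumes G: "bayes_game G" "k \<le> horizon G" and pos: "\<And>i \<theta>. \<theta> \<in> types G i \<Longrightarrow> \<alpha> i \<theta> > 0"
  shows "optimal G \<alpha> \<sigma> k x \<tau> s \<longleftrightarrow> stage_equilibrium G \<sigma> k x \<tau> \<and>
    (\<forall>i. \<forall>\<theta>\<in>types G i. s i \<theta> = - mixed_payoff G \<sigma> k x \<tau> i \<theta>)"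
proof -
  define tight where "tight \<tau> s \<longleftrightarrow> (\<forall>i. \<forall>\<theta>\<in>types G i. s i \<theta> = - mixed_payoff G \<sigma> k x \<tau> i \<theta>)" for \<tau> s
  note obj = objective_nonpos[where \<alpha> = \<alpha>, OF G pos]
  \<comment> \<open>Once \<open>s\<close> is tight, the constraints say precisely that no pure
    action beats the mixed payoff.\<close>
  have feas: "feasible G \<sigma> k x \<tau> s \<longleftrightarrow> stage_equilibrium G \<sigma> k x \<tau>" if "tight \<tau> s" for \<tau> s
    using that by (auto simp: tight_def feasible_iff stage_equilibrium_def)
  show ?thesis unfolding tight_def[symmetric]
  proof
    assume opt: "optimal G \<alpha> \<sigma> k x \<tau> s"
    then have f: "feasible G \<sigma> k x \<tau> s" by (simp add: optimal_def)
    \<comment> \<open>Existence enters here: it provides a feasible competitor of value 0, so the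
      optimal value cannot be negative.\<close>
    obtain \<tau>' where \<tau>': "stage_equilibrium G \<sigma> k x \<tau>'" using stage_equilibrium_exists[OF G] by blast
    define s' where "s' i \<theta> = - mixed_payoff G \<sigma> k x \<tau>' i \<theta>" for i \<theta>
    have f': "feasible G \<sigma> k x \<tau>' s'" using feas[of \<tau>' s'] \<tau>' by (simp add: tight_def s'_def)
    have "0 \<le> objective G \<alpha> \<sigma> k x \<tau> s"
      using opt f' obj(2)[OF _ f'] unfolding optimal_def by (metis s'_def)
    then have "tight \<tau> s" using obj[OF _ f] by (simp add: tight_def)
    then show "stage_equilibrium G \<sigma> k x \<tau> \<and> tight \<tau> s" using feas f by blast
  next
    assume eq: "stage_equilibrium G \<sigma> k x \<tau> \<and> tight \<tau> s"
    then have f: "feasible G \<sigma> k x \<tau> s" using feas by blast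
    then have "objective G \<alpha> \<sigma> k x \<tau> s = 0" using obj(2)[OF _ f] eq by (simp add: tight_def)
    then show "optimal G \<alpha> \<sigma> k x \<tau> s" using f obj(1) by (auto simp: optimal_def)
  qed
qed

text \<open>An optimal solution need not be what \<open>\<sigma>\<close> prescribes at
  \<open>x\<close>. Its tight \<open>s\<close> then refers to the value of playing it at
  \<open>x\<close> in stage \<open>k\<close> and \<open>\<sigma>\<close> afterwards, expressed by
  \<open>replace_at\<close>.\<close>

theorem theorem2:
  fixes G :: "('x, 't, 'a) bayes_game"
    and \<sigma> :: "player \<Rightarrow> ('x, 't, 'a) strategy"
    and \<alpha> :: "player \<Rightarrow> 't \<Rightarrow> real"
  assumes game: "bayes_game G"
    and strat: "\<And>i. \<sigma> i \<in> strategies G i 0"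
    and final: "\<And>x. x \<in> states G (horizon G) \<Longrightarrow> SBNE_final G \<sigma> x"
    and pos: "\<And>i \<theta>. \<theta> \<in> types G i \<Longrightarrow> \<alpha> i \<theta> > 0"
  shows "(DBNE G \<sigma> \<longleftrightarrow>
            (\<forall>k<horizon G. \<forall>x\<in>states G k. \<exists>s. optimal G \<alpha> \<sigma> k x (\<lambda>i. \<sigma> i k x) s))
       \<and> (\<forall>k<horizon G. \<forall>x\<in>states G k.
            (\<exists>\<tau> s. optimal G \<alpha> \<sigma> k x \<tau> s)
          \<and> (\<forall>\<tau> s. optimal G \<alpha> \<sigma> k x \<tau> s \<longrightarrow>
               (\<forall>i. \<forall>\<theta>\<in>types G i. s i \<theta> = - utility G (replace_at \<sigma> k x \<tau>) i k x \<theta>))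
          \<and> (\<forall>s. optimal G \<alpha> \<sigma> k x (\<lambda>i. \<sigma> i k x) s \<longrightarrow>
               (\<forall>i. \<forall>\<theta>\<in>types G i. s i \<theta> = - utility G \<sigma> i k x \<theta>)))"
proof -
  have strat': "\<sigma> i \<in> strategies G i k" for i k
    using strat[of i] strategies_antimono[of 0 k] by auto
  have opt: "optimal G \<alpha> \<sigma> k x \<tau> s \<longleftrightarrow> stage_equilibrium G \<sigma> k x \<tau> \<and>
      (\<forall>i. \<forall>\<theta>\<in>types G i. s i \<theta> = - mixed_payoff G \<sigma> k x \<tau> i \<theta>)" if "k < horizon G" for k x \<tau> s
    using that by (intro optimal_iff[OF game _ pos]) auto
  \<comment> \<open>The numbers \<open>s\<close> are determined on the type sets by
    \<open>\<tau>\<close>, so asking for some \<open>s\<close> leaves only the equilibrium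
    condition.\<close>
  have opt_ex: "(\<exists>s. optimal G \<alpha> \<sigma> k x \<tau> s) \<longleftrightarrow> stage_equilibrium G \<sigma> k x \<tau>"
    if "k < horizon G" for k x \<tau>
    unfolding opt[OF that] by (auto intro!: exI[of _ "\<lambda>i \<theta>. - mixed_payoff G \<sigma> k x \<tau> i \<theta>"])
  have "DBNE G \<sigma> \<longleftrightarrow> (\<forall>k<horizon G. \<forall>x\<in>states G k. \<exists>s. optimal G \<alpha> \<sigma> k x (\<lambda>i. \<sigma> i k x) s)"
    using DBNE_imp_stage_equilibrium[OF game] stage_equilibrium_imp_DBNE[OF game strat final]
    by (auto simp: opt_ex)
  moreover have "\<exists>\<tau> s. optimal G \<alpha> \<sigma> k x \<tau> s" if "k < horizon G" for k x
    using stage_equilibrium_exists[OF game, of k \<sigma> x] that by (simp add: opt_ex)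
  moreover have "s i \<theta> = - utility G (replace_at \<sigma> k x \<tau>) i k x \<theta>"
    if "k < horizon G" "x \<in> states G k" "optimal G \<alpha> \<sigma> k x \<tau> s" "\<theta> \<in> types G i" for k x \<tau> s i \<theta>
    using that utility_replace_at[OF game strat', of k x \<theta> i \<tau>]
    by (auto simp: opt stage_equilibrium_def)
  moreover have "s i \<theta> = - utility G \<sigma> i k x \<theta>"
    if "k < horizon G" "x \<in> states G k" "optimal G \<alpha> \<sigma> k x (\<lambda>i. \<sigma> i k x) s" "\<theta> \<in> types G i"
    for k x s i \<theta>
    using that utility_eq_mixed_payoff[OF game strat', of k x \<theta> i] by (auto simp: opt)
  ultimately show ?thesis by blast
qed

end
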